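(* Let $\mathcal{C}$ be a fully triangulated category, let $n\ge3$, and let $\delta$ be a distinguished $n$-triangle with objects $a_{i,j}$, $0\le i<j\le n$. Write $F_k$ for the $(n-1)$-triangle face of $\delta$ obtained by discarding all objects having $k$ as an index. Then each map in the canonical cycle of maps of faces $$F_n\to F_{n-1}\to\cdots\to F_1\to F_0\to T$$ is a distinguished map of $(n-1)$-triangles. Here, for $1\le k\le n$, the map $F_k\to F_{k-1}$ matches index $k-1$ of $F_k$ with index $k$ of $F_{k-1}$ and every other index with itself; it is the identity on objects $a_{i,j}$ with $i,j\notin\{k-1,k\}$ and is given by the edges $a_{i,k-1}\to a_{i,k}$ ($i<k-1$) and $a_{k-1,j}\to a_{k,j}$ ($j>k$) of $\delta$. The last term $T$ is the rotated $F_n$, namely the $(n-1)$-triangle indexed by $1<2<\cdots<n$ with $T_{i,j}=a_{i,j}$ for $1\le i<j\le n-1$, $T_{j,n}=a_{0,j}[1]$ for $1\le j\le n-1$, and edges the corresponding (shifted) edges of $\delta$; and $F_0\to T$ is the identity on $a_{i,j}$ ($1\le i<j\le n-1$) and is the edge $a_{j,n}\to a_{0,j}[1]$ of $\delta$ at position $(j,n)$.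
   Context: Setting. $\mathcal{C}$ is an additive category with an additive automorphism $[1]$. For $n\ge 1$, an $n$-triangle (or $R_n$-diagram) $A$ in $\mathcal{C}$ consists of objects $a_{i,j}$ ($0\le i<j\le n$) and, for all $0\le i<j<k\le n$, morphisms (edges) (i) $a_{i,j}\to a_{i,k}$, (ii) $a_{i,k}\to a_{j,k}$, (iii) $a_{j,k}\to a_{i,j}[1]$ ("degree-one edges"), such that: (S) for each index $m$, the edges among $a_{m,m+1},\dots,a_{m,n},a_{0,m}[1],\dots,a_{m-1,m}[1]$ (shifted where needed) form a commuting diagram, so that each edge is the composite of consecutive ones; (Q) for $i<j<k<l$ the squares $a_{i,k}\to a_{i,l}\to a_{j,l}$ $=$ $a_{i,k}\to a_{j,k}\to a_{j,l}$ and $a_{j,l}\to a_{k,l}\to a_{i,k}[1]$ $=$ $a_{j,l}\to a_{i,j}[1]\to a_{i,k}[1]$ commute. A morphism of $n$-triangles is a family of morphisms between corresponding objects commuting with all edges (with $[1]$ applied where appropriate); this gives a category $\Pi_n$. A $2$-triangle is a diagram $a\xrightarrow{u}b\xrightarrow{v}c\xrightarrow{w}a[1]$ ($a=a_{0,1}$, $b=a_{0,2}$, $c=a_{1,2}$), written $(u,v,w)$, and a morphism $(f,g,h):(u,v,w)\to(u',v',w')$ satisfies $gu=u'f$, $hv=v'g$, $f[1]w=w'h$. Faces and degeneracies. For $0\le m\le n$ the face functor $F_m:\Pi_n\to\Pi_{n-1}$ discards all objects having $m$ as an index (and relabels the remaining indices in order). The degeneracy functor $\Pi_{n-1}\to\Pi_n$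 repeats index $m$: with $s:\{0,\dots,n\}\to\{0,\dots,n-1\}$ the monotone surjection hitting $m$ twice, the new object at $(i,j)$ is $a_{s(i),s(j)}$ if $s(i)\ne s(j)$ and $0$ otherwise, with the evident edges (original edges, identities or zeros). Base. An $(n-1)$-simplex diagram is a commuting diagram on a chain $x_1\to x_2\to\cdots\to x_n$; the base of $A$ is $a_{0,1}\to a_{0,2}\to\cdots\to a_{0,n}$. Rotations. $\tau(A)$ has objects $\tau(A)_{0,j}=a_{j-1,n}$ and $\tau(A)_{i,j}=a_{i-1,j-1}[1]$ for $1\le i<j$, with the corresponding (shifted) edges of $A$ but with all degree-one edges of $\tau(A)$ multiplied by $-1$ (for $n=2$: $b\xrightarrow{v}c\xrightarrow{w}a[1]\xrightarrow{-u[1]}b[1]$). $\sigma(A)$ has objects $a_{i,j}[1]$, shifted edges, with degree-one edges multiplied by $-1$. $\mathcal{C}$ is fully triangulated if for each $n\ge2$ there is given a subcategory $D_n\subset\Pi_n$, whose objects are called distinguished $n$-triangles and whose morphisms are called distinguished morphisms (maps), such that for all $n\geq 2$: (1) Isomorphism: any isomorphism between objects of $D_n$ is distinguished, and any object of $\Pi_n$ isomorphic to a distinguished $n$-triangle is distinguished. (2) Rotation: if $A\in D_n$ then $\tau(A),\sigma(A)\in D_n$. (3) Faces: for $n>2$, face functors send distinguished maps of $n$-triangles to distinguished maps of $(n-1)$-triangles, and degeneracy functors send distinguished maps of $(n-1)$-triangles to distinguished maps of $n$-triangles. (4) Bases: every $(n-1)$-simplex diagram is the base of some distinguished $n$-triangle,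 and every map of $(n-1)$-simplex diagrams $\Sigma\to\Sigma'$ extends to a distinguished map between any given distinguished $n$-triangles with bases $\Sigma,\Sigma'$. (5) Lightning strike: if $(f,g,h)$ and $(f,g,h')$ are distinguished maps between the same two distinguished $2$-triangles $(u,v,w)$ and $(u',v',w')$, then $h'-h=v'\theta w$ for some $\theta:a[1]\to b'$. *)

theory Defs
  imports "HOL-Algebra.Group"
begin

section \<open>Additive categories with an additive automorphism\<close>

record ('o, 'a) shift_cat =
  ob :: "'o set"
  arr :: "'a set"
  src :: "'a \<Rightarrow> 'o"
  tgt :: "'a \<Rightarrow> 'o"
  idn :: "'o \<Rightarrow> 'a"
  cmp :: "'a \<Rightarrow> 'a \<Rightarrow> 'a" (infixr "\<cdot>\<index>" 75)
  plus_arr :: "'a \<Rightarrow> 'a \<Rightarrow> 'a" (infixl "\<^bold>+\<index>" 65)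
  zero_arr :: "'o \<Rightarrow> 'o \<Rightarrow> 'a"
  sh_ob :: "'o \<Rightarrow> 'o"
  sh_arr :: "'a \<Rightarrow> 'a"

text \<open>Composition is written in the usual order: \<open>g \<cdot> f\<close> is first \<open>f\<close>, then \<open>g\<close>.\<close>

definition homset :: "('o, 'a, 'z) shift_cat_scheme \<Rightarrow> 'o \<Rightarrow> 'o \<Rightarrow> 'a set" where
  "homset C x y = {f \<in> arr C. src C f = x \<and> tgt C f = y}"

definition homgroup :: "('o, 'a, 'z) shift_cat_scheme \<Rightarrow> 'o \<Rightarrow> 'o \<Rightarrow> 'a monoid" where
  "homgroup C x y = \<lparr>carrier = homset C x y, mult = plus_arr C, one = zero_arr C x y\<rparr>"

definition neg_arr :: "('o, 'a, 'z) shift_cat_scheme \<Rightarrow> 'a \<Rightarrow> 'a" where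
  "neg_arr C f = inv\<^bsub>homgroup C (src C f) (tgt C f)\<^esub> f"

definition zero_object :: "('o, 'a, 'z) shift_cat_scheme \<Rightarrow> 'o \<Rightarrow> bool" where
  "zero_object C z \<longleftrightarrow> z \<in> ob C \<and>
     (\<forall>x \<in> ob C. (\<exists>!f. f \<in> homset C x z) \<and> (\<exists>!f. f \<in> homset C z x))"

definition biproduct ::
  "('o, 'a, 'z) shift_cat_scheme \<Rightarrow> 'o \<Rightarrow> 'o \<Rightarrow> 'o \<Rightarrow> 'a \<Rightarrow> 'a \<Rightarrow> 'a \<Rightarrow> 'a \<Rightarrow> bool" where
  "biproduct C x y p i1 i2 p1 p2 \<longleftrightarrow>
     p \<in> ob C \<and> i1 \<in> homset C x p \<and> i2 \<in> homset C y p \<and>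
     p1 \<in> homset C p x \<and> p2 \<in> homset C p y \<and>
     p1 \<cdot>\<^bsub>C\<^esub> i1 = idn C x \<and> p2 \<cdot>\<^bsub>C\<^esub> i2 = idn C y \<and>
     p2 \<cdot>\<^bsub>C\<^esub> i1 = zero_arr C x y \<and> p1 \<cdot>\<^bsub>C\<^esub> i2 = zero_arr C y x \<and>
     (i1 \<cdot>\<^bsub>C\<^esub> p1) \<^bold>+\<^bsub>C\<^esub> (i2 \<cdot>\<^bsub>C\<^esub> p2) = idn C p"

locale category_axioms =
  fixes C :: "('o, 'a, 'z) shift_cat_scheme" (structure)
  assumes src_ob: "f \<in> arr C \<Longrightarrow> src C f \<in> ob C"
    and tgt_ob: "f \<in> arr C \<Longrightarrow> tgt C f \<in> ob C"
    and idn_hom: "x \<in> ob C \<Longrightarrow> idn C x \<in> homset C x x"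
    and cmp_hom: "f \<in> homset C x y \<Longrightarrow> g \<in> homset C y z \<Longrightarrow> g \<cdot> f \<in> homset C x z"
    and idn_left: "f \<in> homset C x y \<Longrightarrow> idn C y \<cdot> f = f"
    and idn_right: "f \<in> homset C x y \<Longrightarrow> f \<cdot> idn C x = f"
    and cmp_assoc: "f \<in> homset C w x \<Longrightarrow> g \<in> homset C x y \<Longrightarrow> h \<in> homset C y z \<Longrightarrow>
       (h \<cdot> g) \<cdot> f = h \<cdot> (g \<cdot> f)"

locale additive_category = category_axioms +
  assumes hom_comm_group: "x \<in> ob C \<Longrightarrow> y \<in> ob C \<Longrightarrow> comm_group (homgroup C x y)"
    and cmp_plus_left: "f \<in> homset C x y \<Longrightarrow> g \<in> homset C y z \<Longrightarrow> g' \<in> homset C y z \<Longrightarrow>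
       (g \<^bold>+ g') \<cdot> f = (g \<cdot> f) \<^bold>+ (g' \<cdot> f)"
    and cmp_plus_right: "f \<in> homset C x y \<Longrightarrow> f' \<in> homset C x y \<Longrightarrow> g \<in> homset C y z \<Longrightarrow>
       g \<cdot> (f \<^bold>+ f') = (g \<cdot> f) \<^bold>+ (g \<cdot> f')"
    and ex_zero_object: "\<exists>z. zero_object C z"
    and ex_biproduct: "x \<in> ob C \<Longrightarrow> y \<in> ob C \<Longrightarrow> \<exists>p i1 i2 p1 p2. biproduct C x y p i1 i2 p1 p2"

locale shifted_additive_category = additive_category +
  assumes sh_ob_bij: "bij_betw (sh_ob C) (ob C) (ob C)"
    and sh_arr_bij: "bij_betw (sh_arr C) (arr C) (arr C)"
    and sh_hom: "f \<in> homset C x y \<Longrightarrow> sh_arr C f \<in> homset C (sh_ob C x) (sh_ob C y)"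
    and sh_idn: "x \<in> ob C \<Longrightarrow> sh_arr C (idn C x) = idn C (sh_ob C x)"
    and sh_cmp: "f \<in> homset C x y \<Longrightarrow> g \<in> homset C y z \<Longrightarrow>
       sh_arr C (g \<cdot> f) = sh_arr C g \<cdot> sh_arr C f"
    and sh_plus: "f \<in> homset C x y \<Longrightarrow> g \<in> homset C x y \<Longrightarrow>
       sh_arr C (f \<^bold>+ g) = sh_arr C f \<^bold>+ sh_arr C g"


section \<open>The category of n-triangles\<close>

text \<open>
  For \<open>i < j < k\<close> the edges are
  \<open>edge1 i j k : a_{i,j} \<rightarrow> a_{i,k}\<close>, \<open>edge2 i j k : a_{i,k} \<rightarrow> a_{j,k}\<close> and
  \<open>edge3 i j k : a_{j,k} \<rightarrow> a_{i,j}[1]\<close>.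
  All families are \<open>undefined\<close> outside their index range, so that equality of the records
  is equality of diagrams.
\<close>

record ('o, 'a) tri =
  vtx :: "nat \<Rightarrow> nat \<Rightarrow> 'o"
  edge1 :: "nat \<Rightarrow> nat \<Rightarrow> nat \<Rightarrow> 'a"
  edge2 :: "nat \<Rightarrow> nat \<Rightarrow> nat \<Rightarrow> 'a"
  edge3 :: "nat \<Rightarrow> nat \<Rightarrow> nat \<Rightarrow> 'a"

type_synonym 'a trimap = "nat \<Rightarrow> nat \<Rightarrow> 'a"

definition restr2 :: "nat \<Rightarrow> (nat \<Rightarrow> nat \<Rightarrow> 'b) \<Rightarrow> nat \<Rightarrow> nat \<Rightarrow> 'b" where
  "restr2 n f = (\<lambda>i j. if i < j \<and> j \<le> n then f i j else undefined)"

definition restr3 :: "nat \<Rightarrow> (nat \<Rightarrow> nat \<Rightarrow> nat \<Rightarrow> 'b) \<Rightarrow> nat \<Rightarrow> nat \<Rightarrow> nat \<Rightarrow> 'b" where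
  "restr3 n f = (\<lambda>i j k. if i < j \<and> j < k \<and> k \<le> n then f i j k else undefined)"

definition mk_tri :: "nat \<Rightarrow> (nat \<Rightarrow> nat \<Rightarrow> 'o) \<Rightarrow> (nat \<Rightarrow> nat \<Rightarrow> nat \<Rightarrow> 'a) \<Rightarrow>
    (nat \<Rightarrow> nat \<Rightarrow> nat \<Rightarrow> 'a) \<Rightarrow> (nat \<Rightarrow> nat \<Rightarrow> nat \<Rightarrow> 'a) \<Rightarrow> ('o, 'a) tri" where
  "mk_tri n V E1 E2 E3 =
     \<lparr>vtx = restr2 n V, edge1 = restr3 n E1, edge2 = restr3 n E2, edge3 = restr3 n E3\<rparr>"

definition tri_graph :: "('o, 'a, 'z) shift_cat_scheme \<Rightarrow> nat \<Rightarrow> ('o, 'a) tri \<Rightarrow> bool" where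
  "tri_graph C n A \<longleftrightarrow>
     A = mk_tri n (vtx A) (edge1 A) (edge2 A) (edge3 A) \<and>
     (\<forall>i j. i < j \<and> j \<le> n \<longrightarrow> vtx A i j \<in> ob C) \<and>
     (\<forall>i j k. i < j \<and> j < k \<and> k \<le> n \<longrightarrow>
        edge1 A i j k \<in> homset C (vtx A i j) (vtx A i k) \<and>
        edge2 A i j k \<in> homset C (vtx A i k) (vtx A j k) \<and>
        edge3 A i j k \<in> homset C (vtx A j k) (sh_ob C (vtx A i j)))"

text \<open>
  Condition (S): fix an index \<open>m\<close>, and order the objects as
  \<open>a_{m,m+1}, ..., a_{m,n}, a_{0,m}[1], ..., a_{m-1,m}[1]\<close>.  There is one edge from each object
  to each later one, and commutativity says that any two successive edges compose to the third;
  the four clauses correspond to how many of the three objects lie in the shifted part (0 to 3).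
\<close>

definition tri_S :: "('o, 'a, 'z) shift_cat_scheme \<Rightarrow> nat \<Rightarrow> ('o, 'a) tri \<Rightarrow> bool" where
  "tri_S C n A \<longleftrightarrow> (\<forall>m \<le> n.
     (\<forall>j k l. m < j \<and> j < k \<and> k < l \<and> l \<le> n \<longrightarrow>
        edge1 A m k l \<cdot>\<^bsub>C\<^esub> edge1 A m j k = edge1 A m j l) \<and>
     (\<forall>i j k. i < m \<and> m < j \<and> j < k \<and> k \<le> n \<longrightarrow>
        edge3 A i m k \<cdot>\<^bsub>C\<^esub> edge1 A m j k = edge3 A i m j) \<and>
     (\<forall>i j k. i < j \<and> j < m \<and> m < k \<and> k \<le> n \<longrightarrow>
        sh_arr C (edge2 A i j m) \<cdot>\<^bsub>C\<^esub> edge3 A i m k = edge3 A j m k) \<and>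
     (\<forall>h i j. h < i \<and> i < j \<and> j < m \<longrightarrow>
        sh_arr C (edge2 A i j m) \<cdot>\<^bsub>C\<^esub> sh_arr C (edge2 A h i m) = sh_arr C (edge2 A h j m)))"

definition tri_Q :: "('o, 'a, 'z) shift_cat_scheme \<Rightarrow> nat \<Rightarrow> ('o, 'a) tri \<Rightarrow> bool" where
  "tri_Q C n A \<longleftrightarrow> (\<forall>i j k l. i < j \<and> j < k \<and> k < l \<and> l \<le> n \<longrightarrow>
     edge2 A i j l \<cdot>\<^bsub>C\<^esub> edge1 A i k l = edge1 A j k l \<cdot>\<^bsub>C\<^esub> edge2 A i j k \<and>
     edge3 A i k l \<cdot>\<^bsub>C\<^esub> edge2 A j k l = sh_arr C (edge1 A i j k) \<cdot>\<^bsub>C\<^esub> edge3 A i j l)"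

definition triangle :: "('o, 'a, 'z) shift_cat_scheme \<Rightarrow> nat \<Rightarrow> ('o, 'a) tri \<Rightarrow> bool" where
  "triangle C n A \<longleftrightarrow> tri_graph C n A \<and> tri_S C n A \<and> tri_Q C n A"

definition tri_map :: "('o, 'a, 'z) shift_cat_scheme \<Rightarrow> nat \<Rightarrow>
    ('o, 'a) tri \<Rightarrow> ('o, 'a) tri \<Rightarrow> 'a trimap \<Rightarrow> bool" where
  "tri_map C n A B \<phi> \<longleftrightarrow>
     triangle C n A \<and> triangle C n B \<and> \<phi> = restr2 n \<phi> \<and>
     (\<forall>i j. i < j \<and> j \<le> n \<longrightarrow> \<phi> i j \<in> homset C (vtx A i j) (vtx B i j)) \<and>
     (\<forall>i j k. i < j \<and> j < k \<and> k \<le> n \<longrightarrow>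
        \<phi> i k \<cdot>\<^bsub>C\<^esub> edge1 A i j k = edge1 B i j k \<cdot>\<^bsub>C\<^esub> \<phi> i j \<and>
        \<phi> j k \<cdot>\<^bsub>C\<^esub> edge2 A i j k = edge2 B i j k \<cdot>\<^bsub>C\<^esub> \<phi> i k \<and>
        sh_arr C (\<phi> i j) \<cdot>\<^bsub>C\<^esub> edge3 A i j k = edge3 B i j k \<cdot>\<^bsub>C\<^esub> \<phi> j k)"

definition tri_id :: "('o, 'a, 'z) shift_cat_scheme \<Rightarrow> nat \<Rightarrow> ('o, 'a) tri \<Rightarrow> 'a trimap" where
  "tri_id C n A = restr2 n (\<lambda>i j. idn C (vtx A i j))"

definition tri_cmp :: "('o, 'a, 'z) shift_cat_scheme \<Rightarrow> nat \<Rightarrow>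
    'a trimap \<Rightarrow> 'a trimap \<Rightarrow> 'a trimap" where
  "tri_cmp C n \<psi> \<phi> = restr2 n (\<lambda>i j. \<psi> i j \<cdot>\<^bsub>C\<^esub> \<phi> i j)"

definition tri_iso :: "('o, 'a, 'z) shift_cat_scheme \<Rightarrow> nat \<Rightarrow>
    ('o, 'a) tri \<Rightarrow> ('o, 'a) tri \<Rightarrow> 'a trimap \<Rightarrow> bool" where
  "tri_iso C n A B \<phi> \<longleftrightarrow> tri_map C n A B \<phi> \<and>
     (\<exists>\<psi>. tri_map C n B A \<psi> \<and> tri_cmp C n \<psi> \<phi> = tri_id C n A \<and> tri_cmp C n \<phi> \<psi> = tri_id C n B)"


section \<open>Faces, degeneracies, bases, rotations\<close>

definition skip :: "nat \<Rightarrow> nat \<Rightarrow> nat" where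
  "skip m i = (if i < m then i else Suc i)"

definition rept :: "nat \<Rightarrow> nat \<Rightarrow> nat" where
  "rept m i = (if i \<le> m then i else i - 1)"

text \<open>\<open>face n m\<close> goes from n-triangles to (n-1)-triangles, \<open>degen C n m\<close> the other way.\<close>

definition face :: "nat \<Rightarrow> nat \<Rightarrow> ('o, 'a) tri \<Rightarrow> ('o, 'a) tri" where
  "face n m A = mk_tri (n - 1)
     (\<lambda>i j. vtx A (skip m i) (skip m j))
     (\<lambda>i j k. edge1 A (skip m i) (skip m j) (skip m k))
     (\<lambda>i j k. edge2 A (skip m i) (skip m j) (skip m k))
     (\<lambda>i j k. edge3 A (skip m i) (skip m j) (skip m k))"

definition face_map :: "nat \<Rightarrow> nat \<Rightarrow> 'a trimap \<Rightarrow> 'a trimap" where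
  "face_map n m \<phi> = restr2 (n - 1) (\<lambda>i j. \<phi> (skip m i) (skip m j))"

text \<open>
  A fixed choice of zero object.  A different choice gives isomorphic degeneracies, so it does
  not affect which triangles and maps are distinguished.
\<close>

definition zob :: "('o, 'a, 'z) shift_cat_scheme \<Rightarrow> 'o" where
  "zob C = (SOME z. zero_object C z)"

text \<open>
  \<open>degen\<close> is defined on all diagrams.  Condition (Q) for its value amounts to the vanishing of
  the composites \<open>a_{i,j} \<rightarrow> a_{i,k} \<rightarrow> a_{j,k} \<rightarrow> a_{i,j}[1] \<rightarrow> a_{i,k}[1]\<close> of successive edges
  that involve the repeated index; the face axiom of fully triangulated categories below
  includes that it holds for distinguished triangles.
\<close>

definition degen :: "('o, 'a, 'z) shift_cat_scheme \<Rightarrow> nat \<Rightarrow> nat \<Rightarrow> ('o, 'a) tri \<Rightarrow> ('o, 'a) tri" where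
  "degen C n m A = (let s = rept m in mk_tri n
     (\<lambda>i j. if s i = s j then zob C else vtx A (s i) (s j))
     (\<lambda>i j k. if s i = s j then zero_arr C (zob C) (vtx A (s i) (s k))
              else if s j = s k then idn C (vtx A (s i) (s j))
              else edge1 A (s i) (s j) (s k))
     (\<lambda>i j k. if s i = s j then idn C (vtx A (s i) (s k))
              else if s j = s k then zero_arr C (vtx A (s i) (s k)) (zob C)
              else edge2 A (s i) (s j) (s k))
     (\<lambda>i j k. if s i = s j then zero_arr C (vtx A (s j) (s k)) (sh_ob C (zob C))
              else if s j = s k then zero_arr C (zob C) (sh_ob C (vtx A (s i) (s j)))
              else edge3 A (s i) (s j) (s k)))"

definition degen_map ::
  "('o, 'a, 'z) shift_cat_scheme \<Rightarrow> nat \<Rightarrow> nat \<Rightarrow> 'a trimap \<Rightarrow> 'a trimap" where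
  "degen_map C n m \<phi> = (let s = rept m in
     restr2 n (\<lambda>i j. if s i = s j then zero_arr C (zob C) (zob C) else \<phi> (s i) (s j)))"

text \<open>
  A commuting diagram on a chain \<open>x_1 \<rightarrow> ... \<rightarrow> x_n\<close>, with all its edges
  \<open>sedge i j : x_i \<rightarrow> x_j\<close> for \<open>1 \<le> i < j \<le> n\<close>.
\<close>

record ('o, 'a) simplex =
  svtx :: "nat \<Rightarrow> 'o"
  sedge :: "nat \<Rightarrow> nat \<Rightarrow> 'a"

definition mk_simplex :: "nat \<Rightarrow> (nat \<Rightarrow> 'o) \<Rightarrow> (nat \<Rightarrow> nat \<Rightarrow> 'a) \<Rightarrow> ('o, 'a) simplex" where
  "mk_simplex n X E =
     \<lparr>svtx = (\<lambda>i. if 1 \<le> i \<and> i \<le> n then X i else undefined),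
      sedge = (\<lambda>i j. if 1 \<le> i \<and> i < j \<and> j \<le> n then E i j else undefined)\<rparr>"

definition simplex_diagram ::
  "('o, 'a, 'z) shift_cat_scheme \<Rightarrow> nat \<Rightarrow> ('o, 'a) simplex \<Rightarrow> bool" where
  "simplex_diagram C n X \<longleftrightarrow>
     X = mk_simplex n (svtx X) (sedge X) \<and>
     (\<forall>i. 1 \<le> i \<and> i \<le> n \<longrightarrow> svtx X i \<in> ob C) \<and>
     (\<forall>i j. 1 \<le> i \<and> i < j \<and> j \<le> n \<longrightarrow> sedge X i j \<in> homset C (svtx X i) (svtx X j)) \<and>
     (\<forall>i j k. 1 \<le> i \<and> i < j \<and> j < k \<and> k \<le> n \<longrightarrow>
        sedge X j k \<cdot>\<^bsub>C\<^esub> sedge X i j = sedge X i k)"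

definition simplex_map :: "('o, 'a, 'z) shift_cat_scheme \<Rightarrow> nat \<Rightarrow>
    ('o, 'a) simplex \<Rightarrow> ('o, 'a) simplex \<Rightarrow> (nat \<Rightarrow> 'a) \<Rightarrow> bool" where
  "simplex_map C n X Y f \<longleftrightarrow>
     simplex_diagram C n X \<and> simplex_diagram C n Y \<and>
     (\<forall>i. 1 \<le> i \<and> i \<le> n \<longrightarrow> f i \<in> homset C (svtx X i) (svtx Y i)) \<and>
     (\<forall>i j. 1 \<le> i \<and> i < j \<and> j \<le> n \<longrightarrow>
        f j \<cdot>\<^bsub>C\<^esub> sedge X i j = sedge Y i j \<cdot>\<^bsub>C\<^esub> f i)"

definition base :: "nat \<Rightarrow> ('o, 'a) tri \<Rightarrow> ('o, 'a) simplex" where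
  "base n A = mk_simplex n (\<lambda>j. vtx A 0 j) (\<lambda>j k. edge1 A 0 j k)"

definition rot :: "('o, 'a, 'z) shift_cat_scheme \<Rightarrow> nat \<Rightarrow> ('o, 'a) tri \<Rightarrow> ('o, 'a) tri" where
  "rot C n A = mk_tri n
     (\<lambda>i j. if i = 0 then vtx A (j - 1) n else sh_ob C (vtx A (i - 1) (j - 1)))
     (\<lambda>i j k. if i = 0 then edge2 A (j - 1) (k - 1) n
              else sh_arr C (edge1 A (i - 1) (j - 1) (k - 1)))
     (\<lambda>i j k. if i = 0 then edge3 A (j - 1) (k - 1) n
              else sh_arr C (edge2 A (i - 1) (j - 1) (k - 1)))
     (\<lambda>i j k. if i = 0 then neg_arr C (sh_arr C (edge1 A (j - 1) (k - 1) n))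
              else neg_arr C (sh_arr C (edge3 A (i - 1) (j - 1) (k - 1))))"

definition susp :: "('o, 'a, 'z) shift_cat_scheme \<Rightarrow> nat \<Rightarrow> ('o, 'a) tri \<Rightarrow> ('o, 'a) tri" where
  "susp C n A = mk_tri n
     (\<lambda>i j. sh_ob C (vtx A i j))
     (\<lambda>i j k. sh_arr C (edge1 A i j k))
     (\<lambda>i j k. sh_arr C (edge2 A i j k))
     (\<lambda>i j k. neg_arr C (sh_arr C (edge3 A i j k)))"


section \<open>Fully triangulated categories\<close>

text \<open>
  \<open>D n\<close> is the class of distinguished n-triangles and \<open>M n A B\<close> the set of distinguished maps
  \<open>A \<rightarrow> B\<close>; only \<open>n \<ge> 2\<close> matters.
\<close>

locale fully_triangulated = shifted_additive_category C
  for C :: "('o, 'a, 'z) shift_cat_scheme" (structure) +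
  fixes D :: "nat \<Rightarrow> ('o, 'a) tri set"
    and M :: "nat \<Rightarrow> ('o, 'a) tri \<Rightarrow> ('o, 'a) tri \<Rightarrow> 'a trimap set"
  assumes D_triangle: "n \<ge> 2 \<Longrightarrow> A \<in> D n \<Longrightarrow> triangle C n A"
    and M_tri_map: "n \<ge> 2 \<Longrightarrow> \<phi> \<in> M n A B \<Longrightarrow> A \<in> D n \<and> B \<in> D n \<and> tri_map C n A B \<phi>"
    and M_id: "n \<ge> 2 \<Longrightarrow> A \<in> D n \<Longrightarrow> tri_id C n A \<in> M n A A"
    and M_cmp: "n \<ge> 2 \<Longrightarrow> \<phi> \<in> M n A B \<Longrightarrow> \<psi> \<in> M n B E \<Longrightarrow> tri_cmp C n \<psi> \<phi> \<in> M n A E"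
    and iso_map: "n \<ge> 2 \<Longrightarrow> A \<in> D n \<Longrightarrow> B \<in> D n \<Longrightarrow> tri_iso C n A B \<phi> \<Longrightarrow> \<phi> \<in> M n A B"
    and iso_closed: "n \<ge> 2 \<Longrightarrow> A \<in> D n \<Longrightarrow> tri_iso C n A B \<phi> \<Longrightarrow> B \<in> D n"
    and rotation: "n \<ge> 2 \<Longrightarrow> A \<in> D n \<Longrightarrow> rot C n A \<in> D n"
    and suspension: "n \<ge> 2 \<Longrightarrow> A \<in> D n \<Longrightarrow> susp C n A \<in> D n"
    and faces: "n > 2 \<Longrightarrow> m \<le> n \<Longrightarrow> \<phi> \<in> M n A B \<Longrightarrow>
       face_map n m \<phi> \<in> M (n - 1) (face n m A) (face n m B)"
    and degeneracies: "n > 2 \<Longrightarrow> m \<le> n - 1 \<Longrightarrow> \<phi> \<in> M (n - 1) A B \<Longrightarrow>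
       degen_map C n m \<phi> \<in> M n (degen C n m A) (degen C n m B)"
    and ex_base: "n \<ge> 2 \<Longrightarrow> simplex_diagram C n X \<Longrightarrow> \<exists>A \<in> D n. base n A = X"
    and extend_base: "n \<ge> 2 \<Longrightarrow> A \<in> D n \<Longrightarrow> B \<in> D n \<Longrightarrow>
       simplex_map C n (base n A) (base n B) f \<Longrightarrow>
       \<exists>\<phi> \<in> M n A B. \<forall>j. 1 \<le> j \<and> j \<le> n \<longrightarrow> \<phi> 0 j = f j"
    and lightning: "\<phi> \<in> M 2 A B \<Longrightarrow> \<psi> \<in> M 2 A B \<Longrightarrow> \<phi> 0 1 = \<psi> 0 1 \<Longrightarrow> \<phi> 0 2 = \<psi> 0 2 \<Longrightarrow>
       \<exists>\<theta> \<in> homset C (sh_ob C (vtx A 0 1)) (vtx B 0 2).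
         \<psi> 1 2 \<^bold>+ neg_arr C (\<phi> 1 2) = edge2 B 0 1 2 \<cdot> \<theta> \<cdot> edge3 A 0 1 2"


section \<open>The cycle of faces\<close>

text \<open>
  All (n-1)-triangles below are indexed by positions \<open>0, ..., n-1\<close>.  The k-th face has index
  \<open>skip k p\<close> at position \<open>p\<close>; the k-th and (k-1)-st faces differ only in position \<open>k - 1\<close>, which
  holds index \<open>k - 1\<close> and \<open>k\<close>, respectively.
\<close>

definition face_step ::
  "('o, 'a, 'z) shift_cat_scheme \<Rightarrow> nat \<Rightarrow> ('o, 'a) tri \<Rightarrow> nat \<Rightarrow> 'a trimap" where
  "face_step C n A k = restr2 (n - 1) (\<lambda>p q.
     if q = k - 1 then edge1 A p (k - 1) k
     else if p = k - 1 then edge2 A (k - 1) k (Suc q)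
     else idn C (vtx A (skip k p) (skip k q)))"

text \<open>
  Position \<open>p\<close> of \<open>rotated_face\<close> is the index \<open>p + 1\<close> of the final triangle of the cycle, whose
  indices are \<open>1 < ... < n\<close>.  No signs occur: \<open>rot\<close> takes it to \<open>susp\<close> of the n-th face.
\<close>

definition rotated_face ::
  "('o, 'a, 'z) shift_cat_scheme \<Rightarrow> nat \<Rightarrow> ('o, 'a) tri \<Rightarrow> ('o, 'a) tri" where
  "rotated_face C n A = mk_tri (n - 1)
     (\<lambda>p q. if q = n - 1 then sh_ob C (vtx A 0 (Suc p)) else vtx A (Suc p) (Suc q))
     (\<lambda>p q r. if r = n - 1 then edge3 A 0 (Suc p) (Suc q)
              else edge1 A (Suc p) (Suc q) (Suc r))
     (\<lambda>p q r. if r = n - 1 then sh_arr C (edge1 A 0 (Suc p) (Suc q))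
              else edge2 A (Suc p) (Suc q) (Suc r))
     (\<lambda>p q r. if r = n - 1 then sh_arr C (edge2 A 0 (Suc p) (Suc q))
              else edge3 A (Suc p) (Suc q) (Suc r))"

definition last_step ::
  "('o, 'a, 'z) shift_cat_scheme \<Rightarrow> nat \<Rightarrow> ('o, 'a) tri \<Rightarrow> 'a trimap" where
  "last_step C n A = restr2 (n - 1) (\<lambda>p q.
     if q = n - 1 then edge3 A 0 (Suc p) n else idn C (vtx A (Suc p) (Suc q)))"

end

theory Submission
  imports Defs
begin

text \<open>
  A distinguished map is hard to pin down because the extension of a map of bases is not unique.
  Two observations give enough control.

  A distinguished endomorphism that is the identity on the base is an isomorphism
  (\<open>fixes_base_tri_iso\<close>). Every entry \<open>a_{i,j}\<close> lies in the face on the indices \<open>0 < i < j\<close>, a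
  distinguished 2-triangle \<open>(u,v,w)\<close>; comparing the map with the identity, the lightning axiom
  writes it there as \<open>1 + v\<theta>w\<close>, and \<open>wv = 0\<close> makes \<open>v\<theta>w\<close> square to zero. The inverse is again
  distinguished, because isomorphisms are.

  Now let \<open>G\<close> be the face \<open>F_k\<close> with index \<open>k - 1\<close> repeated. The base of \<open>G\<close> maps to the base of
  \<open>\<delta>\<close>, by identities except for \<open>a_{0,k-1} \<rightarrow> a_{0,k}\<close>. Extend this to a distinguished
  map \<open>\<phi> : G \<rightarrow> \<delta>\<close>. Discarding position \<open>k\<close> turns \<open>\<phi>\<close> into an endomorphism of \<open>F_k\<close> that fixes
  the base, so \<open>\<phi>\<close> can be corrected by the degeneracy of its inverse; afterwards \<open>\<phi>\<close> is
  the identity away from position \<open>k\<close>. Position \<open>k\<close> is then determined, because \<open>G\<close> has identity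
  edges between positions \<open>k - 1\<close> and \<open>k\<close>: the components there are edges of \<open>\<delta>\<close>. Discarding
  position \<open>k - 1\<close> instead gives exactly \<open>F_k \<rightarrow> F_{k-1}\<close> (\<open>face_step_distinguished\<close>).

  The map \<open>F_0 \<rightarrow> T\<close> is of the same kind, for the triangle \<open>U\<close> on the indices \<open>1 < ... < n < 0[1]\<close>:
  it is the map from the last face of \<open>U\<close> to the one before. So it remains to see that \<open>U\<close>, the
  inverse rotation of \<open>\<delta>\<close> without signs, is distinguished (\<open>inv_rot_D\<close>). Rotating \<open>U\<close> gives
  the suspension of \<open>\<delta>\<close>, and \<open>n + 1\<close> inverse rotations give the double suspension of \<open>\<delta>\<close>. The
  latter is distinguished; and as a triangle with distinguished suspension is itself distinguished
  (\<open>D_if_susp_D\<close>), one can go back from it, one rotation at a time, to \<open>U\<close>.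
\<close>

section \<open>Arithmetic of arrows\<close>

context category_axioms
begin

lemma hom_ob: "f \<in> homset C x y \<Longrightarrow> x \<in> ob C" "f \<in> homset C x y \<Longrightarrow> y \<in> ob C"
  using src_ob tgt_ob by (auto simp: homset_def)

definition iso_arr :: "'o \<Rightarrow> 'o \<Rightarrow> 'a \<Rightarrow> bool" where
  "iso_arr x y f \<longleftrightarrow> f \<in> homset C x y \<and>
     (\<exists>g \<in> homset C y x. g \<cdot> f = idn C x \<and> f \<cdot> g = idn C y)"

lemma iso_arr_idn: "x \<in> ob C \<Longrightarrow> iso_arr x x (idn C x)"
  unfolding iso_arr_def using idn_hom idn_left by blast

text \<open>
  A left inverse comes from \<open>g \<cdot> f\<close> and a right inverse from \<open>f \<cdot> g\<close>; the two must agree.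
\<close>

lemma iso_arr_if_composites_iso:
  assumes f: "f \<in> homset C x y" and g: "g \<in> homset C y x"
    and gf: "iso_arr x x (g \<cdot> f)" and fg: "iso_arr y y (f \<cdot> g)"
  shows "iso_arr x y f"
proof -
  obtain h where h: "h \<in> homset C x x" "h \<cdot> (g \<cdot> f) = idn C x"
    using gf iso_arr_def by auto
  obtain k where k: "k \<in> homset C y y" "(f \<cdot> g) \<cdot> k = idn C y"
    using fg iso_arr_def by auto
  have l: "h \<cdot> g \<in> homset C y x" and r: "g \<cdot> k \<in> homset C y x"
    using cmp_hom f g h(1) k(1) by blast+
  have lf: "(h \<cdot> g) \<cdot> f = idn C x" using cmp_assoc[OF f g h(1)] h(2) by simp
  have fr: "f \<cdot> (g \<cdot> k) = idn C y" using cmp_assoc[OF k(1) g f] k(2) by simp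
  have "h \<cdot> g = (h \<cdot> g) \<cdot> (f \<cdot> (g \<cdot> k))" using idn_right[OF l] fr by simp
  also have "\<dots> = g \<cdot> k" using cmp_assoc[OF r f l] lf idn_left[OF r] by simp
  finally show ?thesis unfolding iso_arr_def using f l lf fr by auto
qed

end

context additive_category
begin

lemma plus_hom: "f \<in> homset C x y \<Longrightarrow> g \<in> homset C x y \<Longrightarrow> f \<^bold>+ g \<in> homset C x y"
  using comm_groupE(1)[OF hom_comm_group[of x y]] hom_ob by (auto simp: homgroup_def)

lemma zero_hom: "x \<in> ob C \<Longrightarrow> y \<in> ob C \<Longrightarrow> zero_arr C x y \<in> homset C x y"
  using comm_groupE(2)[OF hom_comm_group[of x y]] by (auto simp: homgroup_def)

lemma plus_assoc: "f \<in> homset C x y \<Longrightarrow> g \<in> homset C x y \<Longrightarrow> h \<in> homset C x y \<Longrightarrow>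
   (f \<^bold>+ g) \<^bold>+ h = f \<^bold>+ (g \<^bold>+ h)"
  using comm_groupE(3)[OF hom_comm_group[of x y]] hom_ob by (auto simp: homgroup_def)

lemma plus_comm: "f \<in> homset C x y \<Longrightarrow> g \<in> homset C x y \<Longrightarrow> f \<^bold>+ g = g \<^bold>+ f"
  using comm_groupE(4)[OF hom_comm_group[of x y]] hom_ob by (auto simp: homgroup_def)

lemma zero_plus: "f \<in> homset C x y \<Longrightarrow> zero_arr C x y \<^bold>+ f = f"
  using comm_groupE(5)[OF hom_comm_group[of x y]] hom_ob by (auto simp: homgroup_def)

lemma plus_zero: "f \<in> homset C x y \<Longrightarrow> f \<^bold>+ zero_arr C x y = f"
  using zero_plus plus_comm zero_hom hom_ob by metis

lemma neg_hom: "f \<in> homset C x y \<Longrightarrow> neg_arr C f \<in> homset C x y"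
  and neg_plus: "f \<in> homset C x y \<Longrightarrow> neg_arr C f \<^bold>+ f = zero_arr C x y"
proof -
  assume f: "f \<in> homset C x y"
  interpret H: comm_group "homgroup C x y" using f hom_ob by (intro hom_comm_group)
  have n: "neg_arr C f = inv\<^bsub>homgroup C x y\<^esub> f" using f by (simp add: neg_arr_def homset_def)
  have c: "f \<in> carrier (homgroup C x y)" using f by (simp add: homgroup_def)
  show "neg_arr C f \<in> homset C x y"
    using H.inv_closed[OF c] by (simp add: n homgroup_def)
  show "neg_arr C f \<^bold>+ f = zero_arr C x y"
    using H.l_inv[OF c] unfolding n by (simp add: homgroup_def)
qed

lemma plus_neg: "f \<in> homset C x y \<Longrightarrow> f \<^bold>+ neg_arr C f = zero_arr C x y"
  using neg_plus neg_hom plus_comm by metis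

lemma neg_unique:
  assumes "f \<in> homset C x y" "g \<in> homset C x y" "g \<^bold>+ f = zero_arr C x y"
  shows "g = neg_arr C f"
  using assms neg_hom plus_neg plus_assoc plus_zero zero_plus by metis

lemma zero_unique:
  assumes f: "f \<in> homset C x y" and "f \<^bold>+ f = f"
  shows "f = zero_arr C x y"
  using assms neg_hom plus_neg plus_assoc plus_zero by metis

lemma neg_neg: "f \<in> homset C x y \<Longrightarrow> neg_arr C (neg_arr C f) = f"
  using neg_hom plus_neg neg_unique by metis

lemma cmp_zero_left:
  assumes f: "f \<in> homset C x y" and z: "z \<in> ob C"
  shows "zero_arr C y z \<cdot> f = zero_arr C x z"
proof -
  have z: "zero_arr C y z \<in> homset C y z" using zero_hom hom_ob f z by blast
  show ?thesis
    using zero_unique[OF cmp_hom[OF f z]] cmp_plus_left[OF f z z] plus_zero[OF z] by simp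
qed

lemma cmp_zero_right:
  assumes g: "g \<in> homset C y z" and x: "x \<in> ob C"
  shows "g \<cdot> zero_arr C x y = zero_arr C x z"
proof -
  have z: "zero_arr C x y \<in> homset C x y" using zero_hom hom_ob g x by blast
  show ?thesis
    using zero_unique[OF cmp_hom[OF z g]] cmp_plus_right[OF z z g] plus_zero[OF z] by simp
qed

lemma cmp_neg_left:
  assumes f: "f \<in> homset C x y" and g: "g \<in> homset C y z"
  shows "neg_arr C g \<cdot> f = neg_arr C (g \<cdot> f)"
proof (rule neg_unique[OF cmp_hom[OF f g] cmp_hom[OF f neg_hom[OF g]]])
  show "neg_arr C g \<cdot> f \<^bold>+ g \<cdot> f = zero_arr C x z"
    using cmp_plus_left[OF f neg_hom[OF g] g] neg_plus[OF g] cmp_zero_left[OF f] hom_ob(2)[OF g]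
    by simp
qed

lemma cmp_neg_right:
  assumes f: "f \<in> homset C x y" and g: "g \<in> homset C y z"
  shows "g \<cdot> neg_arr C f = neg_arr C (g \<cdot> f)"
proof (rule neg_unique[OF cmp_hom[OF f g] cmp_hom[OF neg_hom[OF f] g]])
  show "g \<cdot> neg_arr C f \<^bold>+ g \<cdot> f = zero_arr C x z"
    using cmp_plus_right[OF neg_hom[OF f] f g] neg_plus[OF f] cmp_zero_right[OF g] hom_ob(1)[OF f]
    by simp
qed

text \<open>
  The inverse of \<open>1 + N\<close> is \<open>1 - N\<close> when \<open>N\<close> squares to zero. The hypothesis on \<open>h - 1\<close> has the
  form in which the lightning axiom provides it.
\<close>

lemma unipotent_iso_arr:
  assumes h: "h \<in> homset C x x" and N: "N \<in> homset C x x"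
    and hN: "h \<^bold>+ neg_arr C (idn C x) = N" and NN: "N \<cdot> N = zero_arr C x x"
  shows "iso_arr x x h"
proof -
  let ?e = "idn C x" and ?o = "zero_arr C x x"
  have e: "?e \<in> homset C x x" using idn_hom hom_ob h by blast
  have n: "neg_arr C N \<in> homset C x x" using neg_hom N by blast
  have hd: "h = N \<^bold>+ ?e"
    using hN plus_assoc[OF h neg_hom[OF e] e] neg_plus[OF e] plus_zero[OF h] by simp
  let ?g = "neg_arr C N \<^bold>+ ?e"
  have g: "?g \<in> homset C x x" using plus_hom n e by blast
  have zz: "neg_arr C ?o = ?o"
    using neg_unique[of ?o x x ?o] zero_hom hom_ob(1)[OF h] plus_zero by metis
  have gN: "?g \<cdot> N = N"
    using cmp_plus_left[OF N n e] cmp_neg_left[OF N N] NN zz idn_left[OF N] zero_plus[OF N] by simp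
  have Ng: "N \<cdot> ?g = N"
    using cmp_plus_right[OF n e N] cmp_neg_right[OF N N] NN zz idn_right[OF N] zero_plus[OF N]
    by simp
  have cancel: "N \<^bold>+ ?g = ?e"
    using plus_assoc[OF N n e] plus_neg[OF N] zero_plus[OF e] by simp
  have "?g \<cdot> h = ?e"
    unfolding hd using cmp_plus_right[OF N e g] gN idn_right[OF g] cancel by simp
  moreover have "h \<cdot> ?g = ?e"
    unfolding hd using cmp_plus_left[OF g N e] Ng idn_left[OF g] cancel by simp
  ultimately show ?thesis using h g iso_arr_def by blast
qed

lemma zob_zero_object: "zero_object C (zob C)"
  unfolding zob_def using ex_zero_object by (rule someI_ex)

end

context shifted_additive_category
begin

lemma sh_ob_mem: "x \<in> ob C \<Longrightarrow> sh_ob C x \<in> ob C"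
  using sh_ob_bij bij_betwE by blast

lemma sh_ob_inj: "x \<in> ob C \<Longrightarrow> y \<in> ob C \<Longrightarrow> sh_ob C x = sh_ob C y \<longleftrightarrow> x = y"
  using sh_ob_bij by (auto simp: bij_betw_def inj_on_def)

lemma sh_inj: "f \<in> homset C x y \<Longrightarrow> g \<in> homset C x' y' \<Longrightarrow> sh_arr C f = sh_arr C g \<Longrightarrow> f = g"
  using sh_arr_bij by (auto simp: bij_betw_def inj_on_def homset_def)

lemma sh_full:
  assumes f: "f \<in> homset C (sh_ob C x) (sh_ob C y)" and x: "x \<in> ob C" and y: "y \<in> ob C"
  obtains g where "g \<in> homset C x y" "sh_arr C g = f"
proof -
  have "f \<in> arr C" using f by (simp add: homset_def)
  then obtain g where g: "g \<in> arr C" "sh_arr C g = f"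
    using sh_arr_bij unfolding bij_betw_def by (metis imageE)
  have "g \<in> homset C (src C g) (tgt C g)" using g by (simp add: homset_def)
  from sh_hom[OF this] have "sh_ob C (src C g) = sh_ob C x" "sh_ob C (tgt C g) = sh_ob C y"
    using g(2) f by (auto simp: homset_def)
  then have "g \<in> homset C x y"
    using g src_ob tgt_ob x y sh_ob_inj by (simp add: homset_def)
  then show thesis using g(2) that by blast
qed

lemma sh_zero: "x \<in> ob C \<Longrightarrow> y \<in> ob C \<Longrightarrow>
    sh_arr C (zero_arr C x y) = zero_arr C (sh_ob C x) (sh_ob C y)"
  using sh_plus[of "zero_arr C x y" x y "zero_arr C x y"]
  by (intro zero_unique sh_hom) (simp_all add: zero_hom plus_zero[OF zero_hom])

lemma sh_neg:
  assumes f: "f \<in> homset C x y"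
  shows "sh_arr C (neg_arr C f) = neg_arr C (sh_arr C f)"
proof (rule neg_unique[OF sh_hom[OF f] sh_hom[OF neg_hom[OF f]]])
  show "sh_arr C (neg_arr C f) \<^bold>+ sh_arr C f = zero_arr C (sh_ob C x) (sh_ob C y)"
    using sh_plus[OF neg_hom[OF f] f] neg_plus[OF f] sh_zero hom_ob[OF f] by simp
qed

lemma iso_arr_desuspend:
  assumes g: "g \<in> homset C x y" and i: "iso_arr (sh_ob C x) (sh_ob C y) (sh_arr C g)"
  shows "iso_arr x y g"
proof -
  have x: "x \<in> ob C" and y: "y \<in> ob C" using hom_ob g by blast+
  obtain k where k: "k \<in> homset C (sh_ob C y) (sh_ob C x)"
    "k \<cdot> sh_arr C g = idn C (sh_ob C x)" "sh_arr C g \<cdot> k = idn C (sh_ob C y)"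
    using i iso_arr_def by auto
  obtain l where l: "l \<in> homset C y x" "sh_arr C l = k" using sh_full[OF k(1) y x] by blast
  have "l \<cdot> g = idn C x"
    using sh_inj[OF cmp_hom[OF g l(1)] idn_hom[OF x]] sh_cmp[OF g l(1)] l(2) k(2) sh_idn[OF x] by simp
  moreover have "g \<cdot> l = idn C y"
    using sh_inj[OF cmp_hom[OF l(1) g] idn_hom[OF y]] sh_cmp[OF l(1) g] l(2) k(3) sh_idn[OF y] by simp
  ultimately show ?thesis using g l iso_arr_def by blast
qed

end

section \<open>Triangles, maps and isomorphisms\<close>

lemma mk_tri_sel:
  "i < j \<Longrightarrow> j \<le> n \<Longrightarrow> vtx (mk_tri n V E1 E2 E3) i j = V i j"
  "i < j \<Longrightarrow> j < k \<Longrightarrow> k \<le> n \<Longrightarrow> edge1 (mk_tri n V E1 E2 E3) i j k = E1 i j k"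
  "i < j \<Longrightarrow> j < k \<Longrightarrow> k \<le> n \<Longrightarrow> edge2 (mk_tri n V E1 E2 E3) i j k = E2 i j k"
  "i < j \<Longrightarrow> j < k \<Longrightarrow> k \<le> n \<Longrightarrow> edge3 (mk_tri n V E1 E2 E3) i j k = E3 i j k"
  by (simp_all add: mk_tri_def restr2_def restr3_def)

lemma mk_tri_cong:
  assumes "\<And>i j. i < j \<Longrightarrow> j \<le> n \<Longrightarrow> V i j = V' i j"
    and "\<And>i j k. i < j \<Longrightarrow> j < k \<Longrightarrow> k \<le> n \<Longrightarrow> E1 i j k = E1' i j k"
    and "\<And>i j k. i < j \<Longrightarrow> j < k \<Longrightarrow> k \<le> n \<Longrightarrow> E2 i j k = E2' i j k"
    and "\<And>i j k. i < j \<Longrightarrow> j < k \<Longrightarrow> k \<le> n \<Longrightarrow> E3 i j k = E3' i j k"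
  shows "mk_tri n V E1 E2 E3 = mk_tri n V' E1' E2' E3'"
  using assms by (auto simp: mk_tri_def restr2_def restr3_def intro!: ext)

lemma restr2_cong:
  "(\<And>i j. i < j \<Longrightarrow> j \<le> n \<Longrightarrow> f i j = g i j) \<Longrightarrow> restr2 n f = restr2 n g"
  by (auto simp: restr2_def intro!: ext)

lemma restr2_apply: "i < j \<Longrightarrow> j \<le> n \<Longrightarrow> restr2 n f i j = f i j"
  by (simp add: restr2_def)

lemma restr2_idem: "restr2 n (restr2 n f) = restr2 n f"
  by (auto simp: restr2_def intro!: ext)

lemma triangle_eq_mk_tri:
  "triangle C n A \<Longrightarrow> A = mk_tri n (vtx A) (edge1 A) (edge2 A) (edge3 A)"
  by (simp add: triangle_def tri_graph_def)

lemma triangle_vtx: "triangle C n A \<Longrightarrow> i < j \<Longrightarrow> j \<le> n \<Longrightarrow> vtx A i j \<in> ob C"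
  by (simp add: triangle_def tri_graph_def)

lemma triangle_edge:
  assumes "triangle C n A" "i < j" "j < k" "k \<le> n"
  shows "edge1 A i j k \<in> homset C (vtx A i j) (vtx A i k)"
    and "edge2 A i j k \<in> homset C (vtx A i k) (vtx A j k)"
    and "edge3 A i j k \<in> homset C (vtx A j k) (sh_ob C (vtx A i j))"
  using assms by (auto simp: triangle_def tri_graph_def)

lemma tri_map_hom:
  "tri_map C n A B \<phi> \<Longrightarrow> i < j \<Longrightarrow> j \<le> n \<Longrightarrow> \<phi> i j \<in> homset C (vtx A i j) (vtx B i j)"
  by (simp add: tri_map_def)

lemma tri_map_square:
  assumes "tri_map C n A B \<phi>" "i < j" "j < k" "k \<le> n"
  shows "\<phi> i k \<cdot>\<^bsub>C\<^esub> edge1 A i j k = edge1 B i j k \<cdot>\<^bsub>C\<^esub> \<phi> i j"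
    and "\<phi> j k \<cdot>\<^bsub>C\<^esub> edge2 A i j k = edge2 B i j k \<cdot>\<^bsub>C\<^esub> \<phi> i k"
    and "sh_arr C (\<phi> i j) \<cdot>\<^bsub>C\<^esub> edge3 A i j k = edge3 B i j k \<cdot>\<^bsub>C\<^esub> \<phi> j k"
  using assms by (auto simp: tri_map_def)

lemma base_sel:
  "1 \<le> j \<Longrightarrow> j \<le> n \<Longrightarrow> svtx (base n A) j = vtx A 0 j"
  "1 \<le> j \<Longrightarrow> j < k \<Longrightarrow> k \<le> n \<Longrightarrow> sedge (base n A) j k = edge1 A 0 j k"
  by (simp_all add: base_def mk_simplex_def)

lemma simplex_diagram_base: "triangle C n A \<Longrightarrow> simplex_diagram C n (base n A)"
proof -
  assume A: "triangle C n A"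
  have "edge1 A 0 j k \<cdot>\<^bsub>C\<^esub> edge1 A 0 i j = edge1 A 0 i k"
    if "1 \<le> i" "i < j" "j < k" "k \<le> n" for i j k
    using A that unfolding triangle_def tri_S_def by (auto dest!: spec[of _ "0::nat"])
  then show ?thesis
    using triangle_vtx[OF A] triangle_edge[OF A] unfolding simplex_diagram_def
    by (simp add: base_sel) (simp add: base_def mk_simplex_def fun_eq_iff)
qed

context shifted_additive_category
begin

text \<open>
  A commuting square with invertible vertical sides still commutes when these are inverted.
\<close>

lemma inverse_square:
  assumes e: "e \<in> homset C x x'" and e': "e' \<in> homset C y y'"
    and f: "f \<in> homset C x y" and f': "f' \<in> homset C x' y'"
    and g: "g \<in> homset C y x" and g': "g' \<in> homset C y' x'"
    and sq: "f' \<cdot> e = e' \<cdot> f" and fg: "f \<cdot> g = idn C y" and gf': "g' \<cdot> f' = idn C x'"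
  shows "g' \<cdot> e' = e \<cdot> g"
proof -
  have "g' \<cdot> e' = g' \<cdot> (e' \<cdot> (f \<cdot> g))" using idn_right[OF e'] fg by simp
  also have "\<dots> = g' \<cdot> ((f' \<cdot> e) \<cdot> g)" using cmp_assoc[OF g f e'] sq by simp
  also have "\<dots> = (g' \<cdot> f') \<cdot> (e \<cdot> g)"
    using cmp_assoc[OF g e f'] cmp_assoc[OF cmp_hom[OF g e] f' g'] by simp
  finally show ?thesis using gf' idn_left[OF cmp_hom[OF g e]] by simp
qed

lemma tri_iso_if_iso_arr:
  assumes m: "tri_map C n A B \<phi>"
    and i: "\<And>i j. i < j \<Longrightarrow> j \<le> n \<Longrightarrow> iso_arr (vtx A i j) (vtx B i j) (\<phi> i j)"
  shows "tri_iso C n A B \<phi>"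
proof -
  have A: "triangle C n A" and B: "triangle C n B" using m by (simp_all add: tri_map_def)
  have "\<exists>g. i < j \<longrightarrow> j \<le> n \<longrightarrow> g \<in> homset C (vtx B i j) (vtx A i j) \<and>
      g \<cdot> \<phi> i j = idn C (vtx A i j) \<and> \<phi> i j \<cdot> g = idn C (vtx B i j)" for i j
    using i unfolding iso_arr_def by blast
  then obtain \<psi> where \<psi>: "i < j \<Longrightarrow> j \<le> n \<Longrightarrow> \<psi> i j \<in> homset C (vtx B i j) (vtx A i j)"
    "i < j \<Longrightarrow> j \<le> n \<Longrightarrow> \<psi> i j \<cdot> \<phi> i j = idn C (vtx A i j)"
    "i < j \<Longrightarrow> j \<le> n \<Longrightarrow> \<phi> i j \<cdot> \<psi> i j = idn C (vtx B i j)" for i j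
    by metis
  have "tri_map C n B A (restr2 n \<psi>)"
    unfolding tri_map_def
  proof (intro conjI allI impI A B)
    show "restr2 n \<psi> = restr2 n (restr2 n \<psi>)" by (simp add: restr2_idem)
    show "restr2 n \<psi> i j \<in> homset C (vtx B i j) (vtx A i j)" if "i < j \<and> j \<le> n" for i j
      using \<psi>(1) that by (simp add: restr2_apply)
  next
    fix i j k assume ijk: "i < j \<and> j < k \<and> k \<le> n"
    then have r: "i < j" "j < k" "k \<le> n" "i < k" "j \<le> n" by auto
    note R = r(1,5) r(4,3) r(2,3) and a = triangle_edge[OF A r(1-3)] and b = triangle_edge[OF B r(1-3)]
      and s = tri_map_square[OF m r(1-3)]
    note p = tri_map_hom[OF m r(1,5)] tri_map_hom[OF m r(4,3)] tri_map_hom[OF m r(2,3)]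
    note q1 = \<psi>[OF r(1,5)] and q2 = \<psi>[OF r(4,3)] and q3 = \<psi>[OF r(2,3)]
    show "restr2 n \<psi> i k \<cdot> edge1 B i j k = edge1 A i j k \<cdot> restr2 n \<psi> i j"
      using inverse_square[OF a(1) b(1) p(1,2) q1(1) q2(1) s(1) q1(3) q2(2)] r
      by (simp add: restr2_apply)
    show "restr2 n \<psi> j k \<cdot> edge2 B i j k = edge2 A i j k \<cdot> restr2 n \<psi> i k"
      using inverse_square[OF a(2) b(2) p(2,3) q2(1) q3(1) s(2) q2(3) q3(2)] r
      by (simp add: restr2_apply)
    have "sh_arr C (\<psi> i j) \<cdot> sh_arr C (\<phi> i j) = idn C (sh_ob C (vtx A i j))"
      using sh_cmp[OF p(1) q1(1)] q1(2) sh_idn[OF triangle_vtx[OF A r(1,5)]] by simp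
    then show "sh_arr C (restr2 n \<psi> i j) \<cdot> edge3 B i j k = edge3 A i j k \<cdot> restr2 n \<psi> j k"
      using inverse_square[OF a(3) b(3) p(3) sh_hom[OF p(1)] q3(1) sh_hom[OF q1(1)] s(3) q3(3)] r
      by (simp add: restr2_apply)
  qed
  moreover have "tri_cmp C n (restr2 n \<psi>) \<phi> = tri_id C n A"
    "tri_cmp C n \<phi> (restr2 n \<psi>) = tri_id C n B"
    unfolding tri_cmp_def tri_id_def using \<psi> by (auto intro!: restr2_cong simp: restr2_apply)
  ultimately show ?thesis unfolding tri_iso_def using m by blast
qed

end

section \<open>Distinguished maps that fix the base\<close>

lemma skip_surj: "i \<noteq> m \<Longrightarrow> \<exists>p. i = skip m p"
  by (rule exI[of _ "if i < m then i else i - 1"]) (auto simp: skip_def)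

lemma skip_mono: "skip m i < skip m j \<longleftrightarrow> i < j"
  by (auto simp: skip_def)

lemma skip_le_iff: "m \<le> n \<Longrightarrow> n > 0 \<Longrightarrow> skip m p \<le> n \<longleftrightarrow> p \<le> n - 1"
  by (auto simp: skip_def)

lemma face_map_apply:
  "p < q \<Longrightarrow> q \<le> n - 1 \<Longrightarrow> face_map n m \<phi> p q = \<phi> (skip m p) (skip m q)"
  by (simp add: face_map_def restr2_apply)

context fully_triangulated
begin

lemma face_D: "n > 2 \<Longrightarrow> m \<le> n \<Longrightarrow> A \<in> D n \<Longrightarrow> face n m A \<in> D (n - 1)"
  using faces[OF _ _ M_id] M_tri_map[of "n - 1"] by fastforce

lemma degen_D: "n > 2 \<Longrightarrow> m \<le> n - 1 \<Longrightarrow> A \<in> D (n - 1) \<Longrightarrow> degen C n m A \<in> D n"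
  using degeneracies[OF _ _ M_id[of "n - 1"]] M_tri_map[of n] by fastforce

text \<open>
  Repeating index 0 gives a distinguished 3-triangle with a square of type (Q) in which one path is
  \<open>w v\<close> and the other passes through the zero object.
\<close>

lemma consecutive_edges_zero:
  assumes A: "A \<in> D 2"
  shows "edge3 A 0 1 2 \<cdot> edge2 A 0 1 2 = zero_arr C (vtx A 0 2) (sh_ob C (vtx A 0 1))"
proof -
  let ?G = "degen C 3 0 A"
  have "?G \<in> D 3" using degen_D[of 3 0 A] A by simp
  then have "tri_Q C 3 ?G" using D_triangle[of 3] by (simp add: triangle_def)
  then have q: "edge3 ?G 0 2 3 \<cdot> edge2 ?G 1 2 3 = sh_arr C (edge1 ?G 0 1 2) \<cdot> edge3 ?G 0 1 3"
    unfolding tri_Q_def by simp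
  have A2: "triangle C 2 A" using D_triangle A by simp
  have x: "vtx A 0 1 \<in> ob C" "vtx A 0 2 \<in> ob C" using triangle_vtx[OF A2] by auto
  have z: "zob C \<in> ob C" using zob_zero_object by (simp add: zero_object_def)
  have "edge3 ?G 0 2 3 = edge3 A 0 1 2" "edge2 ?G 1 2 3 = edge2 A 0 1 2"
    "edge1 ?G 0 1 2 = zero_arr C (zob C) (vtx A 0 1)"
    "edge3 ?G 0 1 3 = zero_arr C (vtx A 0 2) (sh_ob C (zob C))"
    by (simp_all add: degen_def Let_def mk_tri_sel rept_def)
  then show ?thesis
    using q sh_zero[OF z x(1)] cmp_zero_left[OF zero_hom[OF x(2) sh_ob_mem[OF z]] sh_ob_mem[OF x(1)]]
    by simp
qed

text \<open>
  The identity is a second distinguished map with the same first two components, so the lightning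
  axiom presents the third component as \<open>1 + v\<theta>w\<close>, where \<open>(v\<theta>w)(v\<theta>w)\<close> contains \<open>w v = 0\<close>.
\<close>

lemma third_component_iso:
  assumes A: "A \<in> D 2" and \<phi>: "\<phi> \<in> M 2 A A"
    and fix01: "\<phi> 0 1 = idn C (vtx A 0 1)" and fix02: "\<phi> 0 2 = idn C (vtx A 0 2)"
  shows "iso_arr (vtx A 1 2) (vtx A 1 2) (\<phi> 1 2)"
proof -
  let ?v = "edge2 A 0 1 2" and ?w = "edge3 A 0 1 2" and ?o = "zero_arr C"
  let ?a = "vtx A 0 1" and ?b = "vtx A 0 2" and ?c = "vtx A 1 2"
  have A2: "triangle C 2 A" using D_triangle A by simp
  have m: "tri_map C 2 A A \<phi>" using M_tri_map \<phi> by simp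
  have v: "?v \<in> homset C ?b ?c" and w: "?w \<in> homset C ?c (sh_ob C ?a)"
    using triangle_edge[OF A2] by auto
  have h: "\<phi> 1 2 \<in> homset C ?c ?c" using tri_map_hom[OF m] by simp
  obtain \<theta> where \<theta>: "\<theta> \<in> homset C (sh_ob C ?a) ?b"
    and e: "\<phi> 1 2 \<^bold>+ neg_arr C (idn C ?c) = ?v \<cdot> \<theta> \<cdot> ?w"
    using lightning[OF M_id[OF _ A] \<phi>] fix01 fix02 by (auto simp: tri_id_def restr2_apply)
  have tw: "\<theta> \<cdot> ?w \<in> homset C ?c ?b" using cmp_hom[OF w \<theta>] .
  have vtw: "?v \<cdot> \<theta> \<cdot> ?w \<in> homset C ?c ?c" using cmp_hom[OF tw v] .
  have "?w \<cdot> (?v \<cdot> \<theta> \<cdot> ?w) = ?o ?c (sh_ob C ?a)"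
    using cmp_assoc[OF tw v w] consecutive_edges_zero[OF A] cmp_zero_left[OF tw] hom_ob(2)[OF w]
    by simp
  then have "(?v \<cdot> \<theta> \<cdot> ?w) \<cdot> (?v \<cdot> \<theta> \<cdot> ?w) = ?o ?c ?c"
    using cmp_assoc[OF vtw tw v] cmp_assoc[OF vtw w \<theta>] cmp_zero_right[OF \<theta>] cmp_zero_right[OF v]
      hom_ob(1)[OF w] by simp
  then show ?thesis using unipotent_iso_arr[OF h vtw e] by simp
qed

text \<open>
  Discarding an index other than \<open>0\<close>, \<open>i\<close> and \<open>j\<close> preserves both the hypothesis and the component
  in question, which leads down to the 2-triangle on \<open>0 < i < j\<close>.
\<close>

lemma fixes_base_iso_arr:
  assumes "n \<ge> 2" "\<phi> \<in> M n A A"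
    and "\<And>j. 1 \<le> j \<Longrightarrow> j \<le> n \<Longrightarrow> \<phi> 0 j = idn C (vtx A 0 j)"
    and "i < j" "j \<le> n"
  shows "iso_arr (vtx A i j) (vtx A i j) (\<phi> i j)"
  using assms
proof (induction n arbitrary: A \<phi> i j rule: dec_induct)
  case base
  then have "A \<in> D 2" using M_tri_map by blast
  then show ?case
    using third_component_iso[of A \<phi>] base triangle_vtx[OF D_triangle[of 2 A]] iso_arr_idn
    by (cases "i = 0") (auto simp: numeral_2_eq_2 less_Suc_eq le_Suc_eq)
next
  case (step n)
  have A: "A \<in> D (Suc n)" and n: "Suc n > 2" using M_tri_map[of "Suc n"] step by auto
  show ?case
  proof (cases "i = 0")
    case True
    then show ?thesis
      using step.prems triangle_vtx[OF D_triangle[OF _ A]] step.hyps iso_arr_idn by simp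
  next
    case False
    have "card {1..Suc n} > card {i, j}" using step.hyps step.prems by simp
    then obtain m where m: "m \<in> {1..Suc n}" "m \<noteq> i" "m \<noteq> j"
      using card_mono[of "{i, j}" "{1..Suc n}"] by force
    let ?F = "face (Suc n) m A" and ?\<phi> = "face_map (Suc n) m \<phi>"
    obtain p q where pq: "i = skip m p" "j = skip m q" using m skip_surj by metis
    have le: "p < q" "q \<le> n"
      using step.prems(3,4) m skip_mono[of m p q] skip_le_iff[of m "Suc n" q] unfolding pq by auto
    have v: "vtx ?F r s = vtx A (skip m r) (skip m s)" if "r < s" "s \<le> n" for r s
      using that by (simp add: face_def mk_tri_sel)
    have p: "?\<phi> r s = \<phi> (skip m r) (skip m s)" if "r < s" "s \<le> n" for r s
      using that by (simp add: face_map_apply)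
    have M: "?\<phi> \<in> M n ?F ?F" using faces[OF n _ step.prems(1), of m] m by simp
    have "?\<phi> 0 s = idn C (vtx ?F 0 s)" if "1 \<le> s" "s \<le> n" for s
      using that v[of 0 s] p[of 0 s] m step.prems(2)[of "skip m s"] by (auto simp: skip_def)
    from step.IH[OF M this le] show ?thesis using v[OF le] p[OF le] pq by simp
  qed
qed

lemma fixes_base_tri_iso:
  assumes n: "n \<ge> 2" and \<phi>: "\<phi> \<in> M n A A"
    and "\<And>j. 1 \<le> j \<Longrightarrow> j \<le> n \<Longrightarrow> \<phi> 0 j = idn C (vtx A 0 j)"
  shows "tri_iso C n A A \<phi>"
  using tri_iso_if_iso_arr fixes_base_iso_arr[OF assms] M_tri_map[OF n \<phi>] by blast

end

section \<open>Adjacent faces\<close>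

lemma rept_skip: "rept (k - 1) (skip (k - 1) p) = p"
  by (auto simp: skip_def rept_def)

lemma rept_skip_Suc: "1 \<le> k \<Longrightarrow> rept (k - 1) (skip k p) = p"
  by (auto simp: skip_def rept_def)

text \<open>
  The simplicial identities \<open>d_m s_l = 1\<close>, for \<open>m = l\<close> and \<open>m = l + 1\<close>.
\<close>

lemma face_degen:
  assumes A: "A = mk_tri (n - 1) (vtx A) (edge1 A) (edge2 A) (edge3 A)" and n: "n > 0" "m \<le> n"
    and r: "\<And>p. rept l (skip m p) = p"
  shows "face n m (degen C n l A) = A"
proof -
  have "face n m (degen C n l A) = mk_tri (n - 1) (vtx A) (edge1 A) (edge2 A) (edge3 A)"
    unfolding face_def degen_def Let_def
    by (rule mk_tri_cong) (simp_all add: r mk_tri_sel skip_mono skip_le_iff[OF n(2,1)])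
  then show ?thesis unfolding A[symmetric] .
qed

lemma rept_eq_iff: "i < j \<Longrightarrow> rept m i = rept m j \<longleftrightarrow> i = m \<and> j = Suc m"
  by (auto simp: rept_def)

lemma rept_less: "i < j \<Longrightarrow> rept m i \<noteq> rept m j \<Longrightarrow> rept m i < rept m j"
  by (auto simp: rept_def)

lemma rept_le: "j \<le> n \<Longrightarrow> m < n \<Longrightarrow> rept m j \<le> n - 1"
  by (auto simp: rept_def)

text \<open>
  Repeating index \<open>k - 1\<close> after discarding index \<open>k\<close> puts \<open>k - 1\<close> into position \<open>k\<close> and leaves
  the other positions alone, so the result can be compared with the original triangle entry by entry.
\<close>

lemma degen_face_sel:
  fixes A :: "('o, 'a) tri" and C :: "('o, 'a, 'z) shift_cat_scheme"
  assumes k: "1 \<le> k" "k \<le> n"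
  defines "G \<equiv> degen C n (k - 1) (face n k A)" and "c \<equiv> (\<lambda>i. if i = k then k - 1 else i)"
  shows "i < j \<Longrightarrow> j \<le> n \<Longrightarrow>
      vtx G i j = (if i = k - 1 \<and> j = k then zob C else vtx A (c i) (c j))"
    and "i < j \<Longrightarrow> j < l \<Longrightarrow> l \<le> n \<Longrightarrow>
      edge1 G i j l = (if i = k - 1 \<and> j = k then zero_arr C (zob C) (vtx A (k - 1) l)
        else if j = k - 1 \<and> l = k then idn C (vtx A i (k - 1)) else edge1 A (c i) (c j) (c l))"
    and "k < l \<Longrightarrow> l \<le> n \<Longrightarrow> edge2 G (k - 1) k l = idn C (vtx A (k - 1) l)"
proof -
  define s where "s = rept (k - 1)"
  have sk: "skip k (s i) = c i" for i using k(1) by (auto simp: s_def skip_def rept_def c_def)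
  have eq: "s i = s j \<longleftrightarrow> i = k - 1 \<and> j = k" if "i < j" for i j
    unfolding s_def using rept_eq_iff[OF that, of "k - 1"] k(1) by auto
  have less: "s i < s j" if "i < j" "\<not> (i = k - 1 \<and> j = k)" for i j
    using rept_less[OF that(1), of "k - 1", folded s_def] eq[OF that(1)] that(2) by blast
  have le: "s j \<le> n - 1" if "j \<le> n" for j using rept_le[OF that, of "k - 1", folded s_def] k by simp
  have V: "vtx (face n k A) (s i) (s j) = vtx A (c i) (c j)"
    if "i < j" "j \<le> n" "\<not> (i = k - 1 \<and> j = k)" for i j
    using less[of i j] le[of j] that by (simp add: face_def mk_tri_sel sk)
  have E: "edge1 (face n k A) (s i) (s j) (s l) = edge1 A (c i) (c j) (c l)"
    if "i < j" "j < l" "l \<le> n" "\<not> (i = k - 1 \<and> j = k)" "\<not> (j = k - 1 \<and> l = k)" for i j l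
    using less[of i j] less[of j l] le[of l] that by (simp add: face_def mk_tri_sel sk)
  show "vtx G i j = (if i = k - 1 \<and> j = k then zob C else vtx A (c i) (c j))"
    if "i < j" "j \<le> n"
    unfolding G_def degen_def Let_def s_def[symmetric] using that V[of i j] eq[of i j] by (simp add: mk_tri_sel)
  show "edge1 G i j l = (if i = k - 1 \<and> j = k then zero_arr C (zob C) (vtx A (k - 1) l)
        else if j = k - 1 \<and> l = k then idn C (vtx A i (k - 1)) else edge1 A (c i) (c j) (c l))"
    if "i < j" "j < l" "l \<le> n"
  proof -
    have d: "edge1 G i j l = (if s i = s j then zero_arr C (zob C) (vtx (face n k A) (s i) (s l))
        else if s j = s l then idn C (vtx (face n k A) (s i) (s j))
        else edge1 (face n k A) (s i) (s j) (s l))"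
      unfolding G_def degen_def Let_def s_def[symmetric] using that by (simp add: mk_tri_sel)
    consider "i = k - 1 \<and> j = k" | "j = k - 1 \<and> l = k"
      | "\<not> (i = k - 1 \<and> j = k)" "\<not> (j = k - 1 \<and> l = k)" by blast
    then show ?thesis
    proof cases
      case 1
      then have "s i = s j" "c i = k - 1" "c l = l" using eq[of i j] that by (auto simp: c_def)
      then show ?thesis using d 1 V[of i l] that by simp
    next
      case 2
      then have "s i \<noteq> s j" "s j = s l" "c i = i" "c j = k - 1"
        using eq[of i j] eq[of j l] that by (auto simp: c_def)
      then show ?thesis using d 2 V[of i j] that by simp
    next
      case 3
      then have "s i \<noteq> s j" "s j \<noteq> s l" using eq[of i j] eq[of j l] that by auto
      then have "edge1 G i j l = edge1 A (c i) (c j) (c l)" using d E[OF that 3] by simp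
      then show ?thesis by (simp only: if_not_P[OF 3(1)] if_not_P[OF 3(2)])
    qed
  qed
  show "edge2 G (k - 1) k l = idn C (vtx A (k - 1) l)" if "k < l" "l \<le> n"
    unfolding G_def degen_def Let_def s_def[symmetric]
    using that V[of "k - 1" l] eq[of "k - 1" k] k
    by (simp add: mk_tri_sel) (simp add: c_def)
qed

context fully_triangulated
begin

text \<open>
  The map is a face of a distinguished map to \<open>A\<close> from the degeneracy of \<open>face n k A\<close> that has index
  \<open>k - 1\<close> in both positions \<open>k - 1\<close> and \<open>k\<close>.
\<close>

lemma face_step_distinguished:
  assumes n: "n \<ge> 3" and A: "A \<in> D n" and k: "1 \<le> k" "k \<le> n"
  shows "face_step C n A k \<in> M (n - 1) (face n k A) (face n (k - 1) A)"
proof -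
  let ?F = "face n k A" and ?G = "degen C n (k - 1) (face n k A)"
  have n2: "n > 2" "n \<ge> 2" "n > 0" "n - 1 \<ge> 2" using n by auto
  have At: "triangle C n A" using D_triangle n2 A by blast
  have F: "?F \<in> D (n - 1)" using face_D n2 k A by blast
  have G: "?G \<in> D n" using degen_D n2 k F by simp
  have Gt: "triangle C n ?G" using D_triangle n2 G by blast
  have Fmk: "?F = mk_tri (n - 1) (vtx ?F) (edge1 ?F) (edge2 ?F) (edge3 ?F)"
    using D_triangle[OF n2(4) F] by (rule triangle_eq_mk_tri)
  have Fv: "vtx ?F p q = vtx A (skip k p) (skip k q)" if "p < q" "q \<le> n - 1" for p q
    using that by (simp add: face_def mk_tri_sel)
  note G_sel = degen_face_sel[OF k, where C = C and A = A]
  note Gv = G_sel(1) and G1 = G_sel(2) and G2 = G_sel(3)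
  have z: "zob C \<in> ob C" using zob_zero_object by (simp add: zero_object_def)
  \<comment> \<open>For \<open>k = 1\<close> position \<open>(0,k)\<close> of \<open>?G\<close> is the zero object rather than \<open>a_{0,k-1}\<close>.\<close>
  define f where "f j = (if j \<noteq> k then idn C (vtx A 0 j)
      else if k = 1 then zero_arr C (zob C) (vtx A 0 1) else edge1 A 0 (k - 1) k)" for j
  have f_hom: "f j \<in> homset C (vtx ?G 0 j) (vtx A 0 j)" if j: "1 \<le> j" "j \<le> n" for j
    using j k Gv[of 0 j] triangle_vtx[OF At, of 0 j] triangle_edge(1)[OF At, of 0 "k - 1" k]
      zero_hom[OF z] idn_hom by (auto simp: f_def)
  have f_sq: "f j \<cdot> edge1 ?G 0 i j = edge1 A 0 i j \<cdot> f i" if ij: "1 \<le> i" "i < j" "j \<le> n" for i j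
  proof -
    have e: "edge1 A 0 i j \<in> homset C (vtx A 0 i) (vtx A 0 j)" using triangle_edge[OF At] ij by simp
    have S: "edge1 A 0 b c \<cdot> edge1 A 0 a b = edge1 A 0 a c"
      if "0 < a" "a < b" "b < c" "c \<le> n" for a b c
      using At that unfolding triangle_def tri_S_def by (auto dest!: spec[of _ "0::nat"])
    consider "i = k" "k = 1" | "i = k" "k > 1" | "i = k - 1" "j = k" | "i < k - 1" "j = k"
      | "i \<noteq> k" "j \<noteq> k" using ij by linarith
    then show ?thesis
    proof cases
      case 1
      have "vtx A 0 j \<in> ob C" using triangle_vtx[OF At] ij by simp
      then show ?thesis
        using 1 ij G1[of 0 i j] cmp_zero_right[OF e z] cmp_zero_right[OF idn_hom z]
        by (simp add: f_def)
    next
      case 2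
      have "edge1 A 0 (k - 1) j \<in> homset C (vtx A 0 (k - 1)) (vtx A 0 j)"
        using triangle_edge[OF At] ij 2 by simp
      then show ?thesis using 2 ij G1[of 0 i j] S[of "k - 1" k j] idn_left by (simp add: f_def)
    next
      case 3
      then have "f j = edge1 A 0 i j" "f i = idn C (vtx A 0 i)" using ij by (auto simp: f_def)
      moreover have "edge1 ?G 0 i j = idn C (vtx A 0 i)" using G1[of 0 i j] 3 ij by auto
      ultimately show ?thesis by simp
    next
      case 4
      then show ?thesis using ij G1[of 0 i j] S[of i "k - 1" k] idn_right[OF e] by (simp add: f_def)
    next
      case 5
      then show ?thesis using ij G1[of 0 i j] idn_right[OF e] idn_left[OF e] by (auto simp: f_def)
    qed
  qed
  have "simplex_map C n (base n ?G) (base n A) f"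
    unfolding simplex_map_def using simplex_diagram_base At Gt f_hom f_sq by (auto simp: base_sel)
  then obtain \<phi> where \<phi>: "\<phi> \<in> M n ?G A" and \<phi>f: "\<And>j. 1 \<le> j \<Longrightarrow> j \<le> n \<Longrightarrow> \<phi> 0 j = f j"
    using extend_base[OF n2(2) G A] by blast
  let ?\<rho> = "face_map n k \<phi>"
  have \<rho>: "?\<rho> \<in> M (n - 1) ?F ?F"
    using faces[OF n2(1) k(2) \<phi>] unfolding face_degen[OF Fmk n2(3) k(2) rept_skip_Suc[OF k(1)]] .
  have "?\<rho> 0 p = idn C (vtx ?F 0 p)" if p: "1 \<le> p" "p \<le> n - 1" for p
  proof -
    have "1 \<le> skip k p" "skip k p \<le> n" "skip k p \<noteq> k" using p k by (auto simp: skip_def)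
    then show ?thesis
      using p k \<phi>f[of "skip k p"] Fv[of 0 p] by (simp add: face_map_apply f_def skip_def)
  qed
  from fixes_base_tri_iso[OF n2(4) \<rho> this] obtain \<psi> where
    \<psi>: "tri_map C (n - 1) ?F ?F \<psi>" "tri_cmp C (n - 1) \<psi> ?\<rho> = tri_id C (n - 1) ?F"
      "tri_cmp C (n - 1) ?\<rho> \<psi> = tri_id C (n - 1) ?F"
    unfolding tri_iso_def by blast
  have "tri_iso C (n - 1) ?F ?F \<psi>"
    unfolding tri_iso_def using \<psi> M_tri_map[OF n2(4) \<rho>] by blast
  then have "\<psi> \<in> M (n - 1) ?F ?F" using iso_map[OF n2(4) F F] by blast
  then have d: "degen_map C n (k - 1) \<psi> \<in> M n ?G ?G" using degeneracies[OF n2(1)] k by simp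
  \<comment> \<open>The correction makes the face at \<open>k\<close> the identity and keeps source and target.\<close>
  define \<chi> where "\<chi> = tri_cmp C n \<phi> (degen_map C n (k - 1) \<psi>)"
  have \<chi>: "\<chi> \<in> M n ?G A" unfolding \<chi>_def using M_cmp[OF n2(2) d \<phi>] .
  then have \<chi>m: "tri_map C n ?G A \<chi>" using M_tri_map n2(2) by blast
  have \<chi>_id: "\<chi> i j = idn C (vtx A i j)" if ij: "i < j" "j \<le> n" "i \<noteq> k" "j \<noteq> k" for i j
  proof -
    obtain p q where pq: "i = skip k p" "j = skip k q" using skip_surj ij by metis
    have le: "p < q" "q \<le> n - 1"
      using ij skip_mono[of k p q] skip_le_iff[OF k(2) n2(3), of q] unfolding pq by auto
    have "\<chi> i j = \<phi> i j \<cdot> \<psi> p q"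
      using ij le rept_skip_Suc[OF k(1)]
      by (simp add: \<chi>_def tri_cmp_def degen_map_def Let_def restr2_apply pq)
    also have "\<dots> = tri_cmp C (n - 1) ?\<rho> \<psi> p q"
      using le by (simp add: tri_cmp_def restr2_apply face_map_apply pq)
    also have "\<dots> = idn C (vtx A i j)" unfolding \<psi>(3) using le Fv by (simp add: tri_id_def restr2_apply pq)
    finally show ?thesis .
  qed
  \<comment> \<open>\<open>?G\<close> has an identity edge from position \<open>(p,k-1)\<close> to \<open>(p,k)\<close>, and in the next step from
      \<open>(k-1,l)\<close> to \<open>(k,l)\<close>, so the squares of \<open>\<chi>\<close> on these edges determine the rest of it.\<close>
  have \<chi>_col: "\<chi> p k = edge1 A p (k - 1) k" if p: "p < k - 1" for p
  proof -
    have le: "p < k" "k - 1 < k" "p < k - 1" "p \<noteq> k" using p by auto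
    have "\<chi> p k \<in> homset C (vtx A p (k - 1)) (vtx A p k)"
      using tri_map_hom[OF \<chi>m le(1) k(2)] Gv[OF le(1) k(2)] le(3,4) by simp
    moreover have "edge1 A p (k - 1) k \<in> homset C (vtx A p (k - 1)) (vtx A p k)"
      using triangle_edge(1)[OF At le(3,2) k(2)] .
    moreover have "edge1 ?G p (k - 1) k = idn C (vtx A p (k - 1))"
      using G1[OF le(3,2) k(2)] le by simp
    moreover have "\<chi> p (k - 1) = idn C (vtx A p (k - 1))" using \<chi>_id[of p "k - 1"] p k by simp
    ultimately show ?thesis
      using tri_map_square(1)[OF \<chi>m le(3,2) k(2)] idn_right by simp
  qed
  have \<chi>_row: "\<chi> k l = edge2 A (k - 1) k l" if l: "k < l" "l \<le> n" for l
  proof -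
    have le: "k - 1 < k" using k by auto
    have "\<chi> k l \<in> homset C (vtx A (k - 1) l) (vtx A k l)"
      using tri_map_hom[OF \<chi>m l] Gv[OF l] l by simp
    moreover have "edge2 A (k - 1) k l \<in> homset C (vtx A (k - 1) l) (vtx A k l)"
      using triangle_edge(2)[OF At le l] .
    moreover have "\<chi> (k - 1) l = idn C (vtx A (k - 1) l)" using \<chi>_id[of "k - 1" l] l k by simp
    ultimately show ?thesis
      using tri_map_square(2)[OF \<chi>m le l] G2[OF l] idn_right by simp
  qed
  have "face_map n (k - 1) \<chi> = face_step C n A k"
    unfolding face_map_def face_step_def
  proof (rule restr2_cong)
    fix p q assume pq: "p < q" "q \<le> n - 1"
    show "\<chi> (skip (k - 1) p) (skip (k - 1) q) = (if q = k - 1 then edge1 A p (k - 1) k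
        else if p = k - 1 then edge2 A (k - 1) k (Suc q)
        else idn C (vtx A (skip k p) (skip k q)))"
    proof -
      consider "q = k - 1" | "p = k - 1" | "p \<noteq> k - 1" "q \<noteq> k - 1" by blast
      then show ?thesis
      proof cases
        case 1
        then show ?thesis using \<chi>_col[of p] pq k by (simp add: skip_def)
      next
        case 2
        then show ?thesis using \<chi>_row[of "Suc q"] pq k by (simp add: skip_def)
      next
        case 3
        then have "skip (k - 1) p = skip k p" "skip (k - 1) q = skip k q" by (auto simp: skip_def)
        moreover have "skip k p \<noteq> k" "skip k q \<noteq> k" by (auto simp: skip_def)
        ultimately show ?thesis
          using 3 \<chi>_id[of "skip k p" "skip k q"] pq skip_mono skip_le_iff[OF k(2) n2(3)] by simp
      qed
    qed
  qed
  moreover have "face n (k - 1) ?G = ?F"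
    using k by (intro face_degen[OF Fmk n2(3)] rept_skip) simp
  ultimately show ?thesis using faces[OF n2(1) _ \<chi>, of "k - 1"] k by simp
qed

end

section \<open>Inverse rotation\<close>

text \<open>
  The triangle on the indices \<open>1 < ... < n < 0[1]\<close> of an n-triangle. The rotated last face of an
  (n+1)-triangle involves only the indices \<open>0, ..., n\<close>, so it can be formed from an n-triangle.
\<close>

abbreviation inv_rot ::
  "('o, 'a, 'z) shift_cat_scheme \<Rightarrow> nat \<Rightarrow> ('o, 'a) tri \<Rightarrow> ('o, 'a) tri" where
  "inv_rot C n A \<equiv> rotated_face C (Suc n) A"

lemma inv_rot_sel:
  "i < j \<Longrightarrow> j \<le> n \<Longrightarrow> vtx (inv_rot C n A) i j =
     (if j = n then sh_ob C (vtx A 0 (Suc i)) else vtx A (Suc i) (Suc j))"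
  "i < j \<Longrightarrow> j < k \<Longrightarrow> k \<le> n \<Longrightarrow> edge1 (inv_rot C n A) i j k =
     (if k = n then edge3 A 0 (Suc i) (Suc j) else edge1 A (Suc i) (Suc j) (Suc k))"
  "i < j \<Longrightarrow> j < k \<Longrightarrow> k \<le> n \<Longrightarrow> edge2 (inv_rot C n A) i j k =
     (if k = n then sh_arr C (edge1 A 0 (Suc i) (Suc j)) else edge2 A (Suc i) (Suc j) (Suc k))"
  "i < j \<Longrightarrow> j < k \<Longrightarrow> k \<le> n \<Longrightarrow> edge3 (inv_rot C n A) i j k =
     (if k = n then sh_arr C (edge2 A 0 (Suc i) (Suc j)) else edge3 A (Suc i) (Suc j) (Suc k))"
  by (simp_all add: rotated_face_def mk_tri_sel)

text \<open>
  In \<open>inv_rot\<close> an index is moved from the front to the back without signs, so the signs introduced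
  by \<open>rot\<close> on the way back are just those of \<open>susp\<close>.
\<close>

lemma rot_inv_rot: "rot C n (inv_rot C n A) = susp C n A"
  unfolding rot_def susp_def by (rule mk_tri_cong) (auto simp: inv_rot_sel)

lemma triangle_S:
  assumes "triangle C n A"
  shows "m < j \<Longrightarrow> j < k \<Longrightarrow> k < l \<Longrightarrow> l \<le> n \<Longrightarrow>
      edge1 A m k l \<cdot>\<^bsub>C\<^esub> edge1 A m j k = edge1 A m j l"
    and "i < m \<Longrightarrow> m < j \<Longrightarrow> j < k \<Longrightarrow> k \<le> n \<Longrightarrow>
      edge3 A i m k \<cdot>\<^bsub>C\<^esub> edge1 A m j k = edge3 A i m j"
    and "i < j \<Longrightarrow> j < m \<Longrightarrow> m < k \<Longrightarrow> k \<le> n \<Longrightarrow>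
      sh_arr C (edge2 A i j m) \<cdot>\<^bsub>C\<^esub> edge3 A i m k = edge3 A j m k"
    and "h < i \<Longrightarrow> i < j \<Longrightarrow> j < m \<Longrightarrow> m \<le> n \<Longrightarrow>
      sh_arr C (edge2 A i j m) \<cdot>\<^bsub>C\<^esub> sh_arr C (edge2 A h i m) = sh_arr C (edge2 A h j m)"
  using assms unfolding triangle_def tri_S_def by simp_all

lemma triangle_Q:
  assumes "triangle C n A" "i < j" "j < k" "k < l" "l \<le> n"
  shows "edge2 A i j l \<cdot>\<^bsub>C\<^esub> edge1 A i k l = edge1 A j k l \<cdot>\<^bsub>C\<^esub> edge2 A i j k"
    and "edge3 A i k l \<cdot>\<^bsub>C\<^esub> edge2 A j k l = sh_arr C (edge1 A i j k) \<cdot>\<^bsub>C\<^esub> edge3 A i j l"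
  using assms unfolding triangle_def tri_Q_def by simp_all

lemma susp_sel:
  "i < j \<Longrightarrow> j \<le> n \<Longrightarrow> vtx (susp C n A) i j = sh_ob C (vtx A i j)"
  "i < j \<Longrightarrow> j < k \<Longrightarrow> k \<le> n \<Longrightarrow> edge1 (susp C n A) i j k = sh_arr C (edge1 A i j k)"
  "i < j \<Longrightarrow> j < k \<Longrightarrow> k \<le> n \<Longrightarrow> edge2 (susp C n A) i j k = sh_arr C (edge2 A i j k)"
  "i < j \<Longrightarrow> j < k \<Longrightarrow> k \<le> n \<Longrightarrow>
    edge3 (susp C n A) i j k = neg_arr C (sh_arr C (edge3 A i j k))"
  by (simp_all add: susp_def mk_tri_sel)

lemma base_susp: "base n (susp C n A) = mk_simplex n
    (\<lambda>j. sh_ob C (svtx (base n A) j)) (\<lambda>j k. sh_arr C (sedge (base n A) j k))"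
  by (auto simp: base_def mk_simplex_def susp_sel fun_eq_iff)

text \<open>
  As long as no index has passed the end, \<open>d\<close> inverse rotations move the window by \<open>d\<close> indices.
\<close>

lemma inv_rot_pow_shift:
  shows "i < j \<Longrightarrow> j + d \<le> n \<Longrightarrow> vtx ((inv_rot C n ^^ d) A) i j = vtx A (i + d) (j + d)"
    and "i < j \<Longrightarrow> j < k \<Longrightarrow> k + d \<le> n \<Longrightarrow>
      edge1 ((inv_rot C n ^^ d) A) i j k = edge1 A (i + d) (j + d) (k + d)"
    and "i < j \<Longrightarrow> j < k \<Longrightarrow> k + d \<le> n \<Longrightarrow>
      edge2 ((inv_rot C n ^^ d) A) i j k = edge2 A (i + d) (j + d) (k + d)"
    and "i < j \<Longrightarrow> j < k \<Longrightarrow> k + d \<le> n \<Longrightarrow>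
      edge3 ((inv_rot C n ^^ d) A) i j k = edge3 A (i + d) (j + d) (k + d)"
  by (induction d arbitrary: i j k) (simp_all add: inv_rot_sel)

text \<open>
  The rotation in which the largest index passes the end and becomes \<open>0[1]\<close>. Along a triple of
  indices the types of the edges are permuted cyclically; two of the three acquire a shift.
\<close>

lemma inv_rot_pow_wrap:
  shows "i < j \<Longrightarrow> j + d = n \<Longrightarrow>
      vtx ((inv_rot C n ^^ Suc d) A) i j = sh_ob C (vtx A 0 (Suc (i + d)))"
    and "i < j \<Longrightarrow> j < k \<Longrightarrow> k + d = n \<Longrightarrow>
      edge1 ((inv_rot C n ^^ Suc d) A) i j k = edge3 A 0 (Suc (i + d)) (Suc (j + d))"
    and "i < j \<Longrightarrow> j < k \<Longrightarrow> k + d = n \<Longrightarrow>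
      edge2 ((inv_rot C n ^^ Suc d) A) i j k = sh_arr C (edge1 A 0 (Suc (i + d)) (Suc (j + d)))"
    and "i < j \<Longrightarrow> j < k \<Longrightarrow> k + d = n \<Longrightarrow>
      edge3 ((inv_rot C n ^^ Suc d) A) i j k = sh_arr C (edge2 A 0 (Suc (i + d)) (Suc (j + d)))"
  unfolding funpow_Suc_right comp_apply
  by (simp_all add: inv_rot_pow_shift inv_rot_sel)

text \<open>
  In a full turn each index passes the end once. An edge on a triple of indices thus goes through
  all three types and is shifted twice; an object has two indices and is shifted twice as well.
\<close>

lemma inv_rot_pow_full_turn:
  shows "i < j \<Longrightarrow> j \<le> n \<Longrightarrow>
      vtx ((inv_rot C n ^^ Suc n) A) i j = sh_ob C (sh_ob C (vtx A i j))"
    and "i < j \<Longrightarrow> j < k \<Longrightarrow> k \<le> n \<Longrightarrow>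
      edge1 ((inv_rot C n ^^ Suc n) A) i j k = sh_arr C (sh_arr C (edge1 A i j k))"
    and "i < j \<Longrightarrow> j < k \<Longrightarrow> k \<le> n \<Longrightarrow>
      edge2 ((inv_rot C n ^^ Suc n) A) i j k = sh_arr C (sh_arr C (edge2 A i j k))"
    and "i < j \<Longrightarrow> j < k \<Longrightarrow> k \<le> n \<Longrightarrow>
      edge3 ((inv_rot C n ^^ Suc n) A) i j k = sh_arr C (sh_arr C (edge3 A i j k))"
proof -
  let ?R = "inv_rot C n"
  show "vtx ((?R ^^ Suc n) A) i j = sh_ob C (sh_ob C (vtx A i j))" if ij: "i < j" "j \<le> n"
  proof -
    \<comment> \<open>Read from the outermost power inwards: \<open>j\<close> passes the end after \<open>s\<close> moves, \<open>i\<close> after \<open>q\<close> more,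
        and the last \<open>i\<close> moves involve no passage.\<close>
    obtain q s where qs: "j = Suc (i + q)" "n = j + s"
      using less_imp_Suc_add[OF ij(1)] le_Suc_ex[OF ij(2)] by blast
    have "Suc n = Suc s + (Suc q + i)" using qs by simp
    then have "(?R ^^ Suc n) A = (?R ^^ Suc s) ((?R ^^ Suc q) ((?R ^^ i) A))"
      by (simp only: funpow_add comp_apply)
    then show ?thesis
      using ij qs by (simp add: inv_rot_pow_wrap inv_rot_pow_shift add.commute del: funpow.simps)
  qed
  assume ijk: "i < j" "j < k" "k \<le> n"
  \<comment> \<open>Here the cuts are at the passages of \<open>k\<close>, \<open>j\<close> and \<open>i\<close>.\<close>
  obtain q r s where qrs: "j = Suc (i + q)" "k = Suc (j + r)" "n = k + s"
    using less_imp_Suc_add[OF ijk(1)] less_imp_Suc_add[OF ijk(2)] le_Suc_ex[OF ijk(3)] by blast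
  have "Suc n = Suc s + (Suc r + (Suc q + i))" using qrs by simp
  then have turn: "(?R ^^ Suc n) A = (?R ^^ Suc s) ((?R ^^ Suc r) ((?R ^^ Suc q) ((?R ^^ i) A)))"
    by (simp only: funpow_add comp_apply)
  show "edge1 ((?R ^^ Suc n) A) i j k = sh_arr C (sh_arr C (edge1 A i j k))"
    "edge2 ((?R ^^ Suc n) A) i j k = sh_arr C (sh_arr C (edge2 A i j k))"
    "edge3 ((?R ^^ Suc n) A) i j k = sh_arr C (sh_arr C (edge3 A i j k))"
    unfolding turn using ijk qrs
    by (simp_all add: inv_rot_pow_wrap inv_rot_pow_shift add_ac del: funpow.simps)
qed


context shifted_additive_category
begin

text \<open>
  Moving an index to the back turns each commutation condition into another one, or into the
  shift of another one. In (S) the chains are only cyclically renumbered, and the two squares of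
  (Q) are exchanged.
\<close>

lemma inv_rot_triangle:
  assumes A: "triangle C n A"
  shows "triangle C n (inv_rot C n A)"
proof -
  let ?R = "inv_rot C n A"
  note S = triangle_S[OF A] and Q = triangle_Q[OF A] and v = triangle_vtx[OF A]
    and e = triangle_edge[OF A]
  have "tri_graph C n ?R"
    unfolding tri_graph_def
  proof (intro conjI allI impI)
    show "?R = mk_tri n (vtx ?R) (edge1 ?R) (edge2 ?R) (edge3 ?R)"
      by (simp add: rotated_face_def mk_tri_def restr2_def restr3_def fun_eq_iff)
    show "vtx ?R i j \<in> ob C" if "i < j \<and> j \<le> n" for i j
      using that v sh_ob_mem by (simp add: inv_rot_sel)
  next
    fix i j k assume "i < j \<and> j < k \<and> k \<le> n"
    then have ijk: "i < j" "j < k" "k \<le> n" by auto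
    show "edge1 ?R i j k \<in> homset C (vtx ?R i j) (vtx ?R i k)"
      using ijk e(1)[of "Suc i" "Suc j" "Suc k"] e(3)[of 0 "Suc i" "Suc j"]
      by (simp add: inv_rot_sel)
    show "edge2 ?R i j k \<in> homset C (vtx ?R i k) (vtx ?R j k)"
      using ijk e(2)[of "Suc i" "Suc j" "Suc k"] sh_hom[OF e(1)[of 0 "Suc i" "Suc j"]]
      by (simp add: inv_rot_sel)
    show "edge3 ?R i j k \<in> homset C (vtx ?R j k) (sh_ob C (vtx ?R i j))"
      using ijk e(3)[of "Suc i" "Suc j" "Suc k"] sh_hom[OF e(2)[of 0 "Suc i" "Suc j"]]
      by (simp add: inv_rot_sel)
  qed
  moreover have "tri_S C n ?R"
    unfolding tri_S_def
  proof (intro conjI allI impI)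
    fix m j k l assume "m < j \<and> j < k \<and> k < l \<and> l \<le> n"
    then show "edge1 ?R m k l \<cdot> edge1 ?R m j k = edge1 ?R m j l" by (auto simp: inv_rot_sel S)
  next
    fix m i j k assume "i < m \<and> m < j \<and> j < k \<and> k \<le> n"
    then show "edge3 ?R i m k \<cdot> edge1 ?R m j k = edge3 ?R i m j" by (auto simp: inv_rot_sel S)
  next
    fix m i j k assume "i < j \<and> j < m \<and> m < k \<and> k \<le> n"
    then show "sh_arr C (edge2 ?R i j m) \<cdot> edge3 ?R i m k = edge3 ?R j m k"
      by (auto simp: inv_rot_sel S)
  next
    fix m h i j assume "m \<le> n" "h < i \<and> i < j \<and> j < m"
    then have h: "h < i" "i < j" "j < m" "m \<le> n" by auto
    have e0: "edge1 A 0 (Suc h) (Suc i) \<in> homset C (vtx A 0 (Suc h)) (vtx A 0 (Suc i))"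
      "edge1 A 0 (Suc i) (Suc j) \<in> homset C (vtx A 0 (Suc i)) (vtx A 0 (Suc j))"
      using e(1) h by auto
    have "sh_arr C (sh_arr C (edge1 A 0 (Suc i) (Suc j))) \<cdot> sh_arr C (sh_arr C (edge1 A 0 (Suc h) (Suc i)))
        = sh_arr C (sh_arr C (edge1 A 0 (Suc h) (Suc j)))"
      using S(1)[of 0 "Suc h" "Suc i" "Suc j"] h sh_cmp[OF e0] sh_cmp[OF sh_hom[OF e0(1)] sh_hom[OF e0(2)]]
      by simp
    then show "sh_arr C (edge2 ?R i j m) \<cdot> sh_arr C (edge2 ?R h i m) = sh_arr C (edge2 ?R h j m)"
      using h by (auto simp: inv_rot_sel S)
  qed
  moreover have "tri_Q C n ?R"
    unfolding tri_Q_def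
  proof (intro allI impI)
    fix i j k l assume "i < j \<and> j < k \<and> k < l \<and> l \<le> n"
    then have h: "i < j" "j < k" "k < l" "l \<le> n" by auto
    have e0: "edge1 A 0 (Suc j) (Suc k) \<in> homset C (vtx A 0 (Suc j)) (vtx A 0 (Suc k))"
      "edge2 A 0 (Suc i) (Suc k) \<in> homset C (vtx A 0 (Suc k)) (vtx A (Suc i) (Suc k))"
      "edge2 A 0 (Suc i) (Suc j) \<in> homset C (vtx A 0 (Suc j)) (vtx A (Suc i) (Suc j))"
      "edge1 A (Suc i) (Suc j) (Suc k) \<in> homset C (vtx A (Suc i) (Suc j)) (vtx A (Suc i) (Suc k))"
      using e(1,2) h by auto
    have "edge2 ?R i j l \<cdot> edge1 ?R i k l = edge1 ?R j k l \<cdot> edge2 ?R i j k"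
      using h Q(1)[of "Suc i" "Suc j" "Suc k" "Suc l"] Q(2)[of 0 "Suc i" "Suc j" "Suc k"]
      by (simp add: inv_rot_sel)
    moreover have "sh_arr C (edge2 A 0 (Suc i) (Suc k)) \<cdot> sh_arr C (edge1 A 0 (Suc j) (Suc k))
        = sh_arr C (edge1 A (Suc i) (Suc j) (Suc k)) \<cdot> sh_arr C (edge2 A 0 (Suc i) (Suc j))"
      using Q(1)[of 0 "Suc i" "Suc j" "Suc k"] h sh_cmp[OF e0(1,2)] sh_cmp[OF e0(3,4)] by simp
    then have "edge3 ?R i k l \<cdot> edge2 ?R j k l = sh_arr C (edge1 ?R i j k) \<cdot> edge3 ?R i j l"
      using h Q(2)[of "Suc i" "Suc j" "Suc k" "Suc l"] by (simp add: inv_rot_sel)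
    ultimately show "edge2 ?R i j l \<cdot> edge1 ?R i k l = edge1 ?R j k l \<cdot> edge2 ?R i j k \<and>
        edge3 ?R i k l \<cdot> edge2 ?R j k l = sh_arr C (edge1 ?R i j k) \<cdot> edge3 ?R i j l" by blast
  qed
  ultimately show ?thesis by (simp add: triangle_def)
qed

lemma inv_rot_pow_triangle: "triangle C n A \<Longrightarrow> triangle C n ((inv_rot C n ^^ d) A)"
  by (induction d) (simp_all add: inv_rot_triangle)

text \<open>
  No signs remain: \<open>inv_rot\<close> has none, and those of the two suspensions cancel.
\<close>

lemma inv_rot_pow_eq_susp_susp:
  assumes A: "triangle C n A"
  shows "(inv_rot C n ^^ Suc n) A = susp C n (susp C n A)"
proof -
  let ?X = "(inv_rot C n ^^ Suc n) A"
  have neg: "neg_arr C (sh_arr C (neg_arr C (sh_arr C (edge3 A i j k)))) =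
      sh_arr C (sh_arr C (edge3 A i j k))" if "i < j" "j < k" "k \<le> n" for i j k
  proof -
    have e: "sh_arr C (edge3 A i j k) \<in> homset C (sh_ob C (vtx A j k)) (sh_ob C (sh_ob C (vtx A i j)))"
      using triangle_edge(3)[OF A that] by (rule sh_hom)
    show ?thesis using sh_neg[OF e] neg_neg[OF sh_hom[OF e]] by simp
  qed
  have "?X = mk_tri n (vtx ?X) (edge1 ?X) (edge2 ?X) (edge3 ?X)"
    using inv_rot_pow_triangle[OF A] by (rule triangle_eq_mk_tri)
  also have "\<dots> = susp C n (susp C n A)"
    unfolding susp_def[of C n "susp C n A"]
    by (rule mk_tri_cong) (simp_all only: inv_rot_pow_full_turn susp_sel neg less_imp_le less_trans)
  finally show ?thesis .
qed

lemma simplex_map_idn: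
  assumes "simplex_diagram C n X"
  shows "simplex_map C n X X (\<lambda>j. idn C (svtx X j))"
proof -
  have v: "svtx X j \<in> ob C" if "1 \<le> j" "j \<le> n" for j
    using assms that unfolding simplex_diagram_def by blast
  have e: "sedge X i j \<in> homset C (svtx X i) (svtx X j)" if "1 \<le> i" "i < j" "j \<le> n" for i j
    using assms that unfolding simplex_diagram_def by blast
  show ?thesis
    unfolding simplex_map_def using assms idn_hom[OF v] idn_left[OF e] idn_right[OF e] by simp
qed

end

section \<open>Desuspension and the last map of the cycle\<close>

context fully_triangulated
begin

text \<open>
  A distinguished triangle \<open>Y\<close> with the base of \<open>X\<close> exists. The suspensions of \<open>X\<close> and \<open>Y\<close> are
  distinguished with the same base, so there are distinguished maps both ways that are identities
  on the base; their composites are isomorphisms, hence so are they. As the shift is an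
  automorphism, this isomorphism desuspends to \<open>Y \<cong> X\<close>.
\<close>

lemma D_if_susp_D:
  assumes n: "n \<ge> 2" and X: "triangle C n X" and SX: "susp C n X \<in> D n"
  shows "X \<in> D n"
proof -
  obtain Y where Y: "Y \<in> D n" "base n Y = base n X"
    using ex_base[OF n simplex_diagram_base[OF X]] by blast
  let ?SX = "susp C n X" and ?SY = "susp C n Y"
  have SY: "?SY \<in> D n" using suspension n Y by blast
  have Yt: "triangle C n Y" and SXt: "triangle C n ?SX" using D_triangle n Y SX by blast+
  have b: "base n ?SY = base n ?SX" using Y(2) by (simp add: base_susp)
  have id: "simplex_map C n (base n ?SX) (base n ?SX) (\<lambda>j. idn C (svtx (base n ?SX) j))"
    using simplex_map_idn[OF simplex_diagram_base[OF SXt]] .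
  obtain \<phi> where \<phi>: "\<phi> \<in> M n ?SY ?SX"
    "\<And>j. 1 \<le> j \<Longrightarrow> j \<le> n \<Longrightarrow> \<phi> 0 j = idn C (svtx (base n ?SX) j)"
    using extend_base[OF n SY SX, unfolded b, OF id] by blast
  obtain \<psi> where \<psi>: "\<psi> \<in> M n ?SX ?SY"
    "\<And>j. 1 \<le> j \<Longrightarrow> j \<le> n \<Longrightarrow> \<psi> 0 j = idn C (svtx (base n ?SX) j)"
    using extend_base[OF n SX SY, unfolded b, OF id] by blast
  have \<phi>m: "tri_map C n ?SY ?SX \<phi>" and \<psi>m: "tri_map C n ?SX ?SY \<psi>"
    using M_tri_map n \<phi>(1) \<psi>(1) by blast+
  have v: "svtx (base n ?SX) j = vtx ?SX 0 j" "vtx ?SY 0 j = vtx ?SX 0 j"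
    if "1 \<le> j" "j \<le> n" for j
    using base_sel(1)[OF that, of ?SX] base_sel(1)[OF that, of ?SY] unfolding b by simp_all
  have idid: "idn C (vtx ?SX 0 l) \<cdot> idn C (vtx ?SX 0 l) = idn C (vtx ?SX 0 l)"
    if "1 \<le> l" "l \<le> n" for l
    using idn_left[OF idn_hom[OF triangle_vtx[OF SXt, of 0 l]]] that by simp
  have iso: "iso_arr (vtx ?SY i j) (vtx ?SX i j) (\<phi> i j)" if ij: "i < j" "j \<le> n" for i j
  proof (rule iso_arr_if_composites_iso[OF tri_map_hom[OF \<phi>m ij] tri_map_hom[OF \<psi>m ij]])
    have "tri_cmp C n \<psi> \<phi> 0 l = idn C (vtx ?SY 0 l)" if l: "1 \<le> l" "l \<le> n" for l
      using \<phi>(2)[OF l] \<psi>(2)[OF l] v[OF l] idid[OF l] l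
      by (simp add: tri_cmp_def restr2_apply)
    from fixes_base_iso_arr[OF n M_cmp[OF n \<phi>(1) \<psi>(1)] this ij]
    show "iso_arr (vtx ?SY i j) (vtx ?SY i j) (\<psi> i j \<cdot> \<phi> i j)"
      using ij by (simp add: tri_cmp_def restr2_apply)
    have "tri_cmp C n \<phi> \<psi> 0 l = idn C (vtx ?SX 0 l)" if l: "1 \<le> l" "l \<le> n" for l
      using \<phi>(2)[OF l] \<psi>(2)[OF l] v[OF l] idid[OF l] l
      by (simp add: tri_cmp_def restr2_apply)
    from fixes_base_iso_arr[OF n M_cmp[OF n \<psi>(1) \<phi>(1)] this ij]
    show "iso_arr (vtx ?SX i j) (vtx ?SX i j) (\<phi> i j \<cdot> \<psi> i j)"
      using ij by (simp add: tri_cmp_def restr2_apply)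
  qed
  have "\<exists>g. i < j \<longrightarrow> j \<le> n \<longrightarrow> g \<in> homset C (vtx Y i j) (vtx X i j) \<and> sh_arr C g = \<phi> i j" for i j
  proof (cases "i < j \<and> j \<le> n")
    case True
    then have ij: "i < j" "j \<le> n" by auto
    have "\<phi> i j \<in> homset C (sh_ob C (vtx Y i j)) (sh_ob C (vtx X i j))"
      using tri_map_hom[OF \<phi>m ij] ij by (simp add: susp_sel)
    then obtain g where "g \<in> homset C (vtx Y i j) (vtx X i j)" "sh_arr C g = \<phi> i j"
      by (rule sh_full[OF _ triangle_vtx[OF Yt ij] triangle_vtx[OF X ij]])
    then show ?thesis by blast
  qed auto
  then obtain \<chi> where \<chi>: "i < j \<Longrightarrow> j \<le> n \<Longrightarrow> \<chi> i j \<in> homset C (vtx Y i j) (vtx X i j)"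
    "i < j \<Longrightarrow> j \<le> n \<Longrightarrow> sh_arr C (\<chi> i j) = \<phi> i j" for i j
    by metis
  have "tri_map C n Y X (restr2 n \<chi>)"
    unfolding tri_map_def
  proof (intro conjI allI impI X Yt)
    show "restr2 n \<chi> = restr2 n (restr2 n \<chi>)" by (simp add: restr2_idem)
    show "restr2 n \<chi> i j \<in> homset C (vtx Y i j) (vtx X i j)" if "i < j \<and> j \<le> n" for i j
      using \<chi>(1) that by (simp add: restr2_apply)
  next
    fix i j k assume "i < j \<and> j < k \<and> k \<le> n"
    then have r: "i < j" "j < k" "k \<le> n" "i < k" "j \<le> n" by auto
    note a = triangle_edge[OF Yt r(1-3)] and c = triangle_edge[OF X r(1-3)]
      and s = tri_map_square[OF \<phi>m r(1-3)]
    note c1 = \<chi>[OF r(1,5)] and c2 = \<chi>[OF r(4,3)] and c3 = \<chi>[OF r(2,3)]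
    note R = restr2_apply[OF r(1,5), of \<chi>] restr2_apply[OF r(4,3), of \<chi>] restr2_apply[OF r(2,3), of \<chi>]
    note sel = susp_sel(2-4)[OF r(1-3)]
    have "\<chi> i k \<cdot> edge1 Y i j k = edge1 X i j k \<cdot> \<chi> i j"
    proof (rule sh_inj[OF cmp_hom[OF a(1) c2(1)] cmp_hom[OF c1(1) c(1)]])
      show "sh_arr C (\<chi> i k \<cdot> edge1 Y i j k) = sh_arr C (edge1 X i j k \<cdot> \<chi> i j)"
        unfolding sh_cmp[OF a(1) c2(1)] sh_cmp[OF c1(1) c(1)] c1(2) c2(2) using s(1) unfolding sel .
    qed
    then show "restr2 n \<chi> i k \<cdot> edge1 Y i j k = edge1 X i j k \<cdot> restr2 n \<chi> i j" unfolding R .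
    have "\<chi> j k \<cdot> edge2 Y i j k = edge2 X i j k \<cdot> \<chi> i k"
    proof (rule sh_inj[OF cmp_hom[OF a(2) c3(1)] cmp_hom[OF c2(1) c(2)]])
      show "sh_arr C (\<chi> j k \<cdot> edge2 Y i j k) = sh_arr C (edge2 X i j k \<cdot> \<chi> i k)"
        unfolding sh_cmp[OF a(2) c3(1)] sh_cmp[OF c2(1) c(2)] c2(2) c3(2) using s(2) unfolding sel .
    qed
    then show "restr2 n \<chi> j k \<cdot> edge2 Y i j k = edge2 X i j k \<cdot> restr2 n \<chi> i k" unfolding R .
    have p: "sh_arr C (\<chi> i j) \<cdot> edge3 Y i j k \<in> homset C (vtx Y j k) (sh_ob C (vtx X i j))"
      and q: "edge3 X i j k \<cdot> \<chi> j k \<in> homset C (vtx Y j k) (sh_ob C (vtx X i j))"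
      by (rule cmp_hom[OF a(3) sh_hom[OF c1(1)]], rule cmp_hom[OF c3(1) c(3)])
    \<comment> \<open>The degree-one edges of a suspension carry a sign on both sides of the square.\<close>
    have "neg_arr C (sh_arr C (sh_arr C (\<chi> i j) \<cdot> edge3 Y i j k)) =
        sh_arr C (sh_arr C (\<chi> i j)) \<cdot> neg_arr C (sh_arr C (edge3 Y i j k))"
      unfolding sh_cmp[OF a(3) sh_hom[OF c1(1)]]
        cmp_neg_right[OF sh_hom[OF a(3)] sh_hom[OF sh_hom[OF c1(1)]]] ..
    also have "\<dots> = neg_arr C (sh_arr C (edge3 X i j k)) \<cdot> sh_arr C (\<chi> j k)"
      using s(3) unfolding c1(2) c3(2) sel .
    also have "\<dots> = neg_arr C (sh_arr C (edge3 X i j k \<cdot> \<chi> j k))"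
      unfolding sh_cmp[OF c3(1) c(3)] cmp_neg_left[OF sh_hom[OF c3(1)] sh_hom[OF c(3)]] ..
    finally have "neg_arr C (neg_arr C (sh_arr C (sh_arr C (\<chi> i j) \<cdot> edge3 Y i j k))) =
        neg_arr C (neg_arr C (sh_arr C (edge3 X i j k \<cdot> \<chi> j k)))" by (rule arg_cong)
    then have "sh_arr C (sh_arr C (\<chi> i j) \<cdot> edge3 Y i j k) = sh_arr C (edge3 X i j k \<cdot> \<chi> j k)"
      unfolding neg_neg[OF sh_hom[OF p]] neg_neg[OF sh_hom[OF q]] .
    from sh_inj[OF p q this]
    show "sh_arr C (restr2 n \<chi> i j) \<cdot> edge3 Y i j k = edge3 X i j k \<cdot> restr2 n \<chi> j k"
      unfolding R .
  qed
  moreover have "iso_arr (vtx Y i j) (vtx X i j) (restr2 n \<chi> i j)" if ij: "i < j" "j \<le> n" for i j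
    using iso_arr_desuspend[OF \<chi>(1)[OF ij]] iso[OF ij] \<chi>(2)[OF ij] ij
    by (simp add: restr2_apply susp_sel)
  ultimately have "tri_iso C n Y X (restr2 n \<chi>)" by (rule tri_iso_if_iso_arr)
  then show ?thesis using iso_closed[OF n Y(1)] by blast
qed

text \<open>
  A descent from a full turn, which is distinguished as a double suspension: if \<open>d + 1\<close> inverse
  rotations give a distinguished triangle, rotating it shows that the suspension of the result
  of \<open>d\<close> inverse rotations is distinguished, and then so is that result.
\<close>

lemma inv_rot_D:
  assumes n: "n \<ge> 2" and A: "A \<in> D n"
  shows "inv_rot C n A \<in> D n"
proof -
  let ?R = "inv_rot C n"
  have At: "triangle C n A" using D_triangle n A by blast
  have "(?R ^^ Suc d) A \<in> D n \<Longrightarrow> ?R A \<in> D n" for d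
  proof (induction d)
    case 0
    then show ?case by simp
  next
    case (Suc d)
    have "rot C n (?R ((?R ^^ Suc d) A)) \<in> D n"
      using rotation[OF n Suc.prems] by simp
    then have "susp C n ((?R ^^ Suc d) A) \<in> D n" unfolding rot_inv_rot .
    then show ?case using Suc.IH D_if_susp_D[OF n inv_rot_pow_triangle[OF At]] by blast
  qed
  moreover have "(?R ^^ Suc n) A \<in> D n"
    unfolding inv_rot_pow_eq_susp_susp[OF At] using suspension n A by blast
  ultimately show ?thesis .
qed

text \<open>
  In the triangle on \<open>1 < ... < n < 0[1]\<close>, discarding the last index gives \<open>F_0\<close>, and discarding the
  one before it, \<open>n\<close>, gives the rotated \<open>F_n\<close>.
\<close>

lemma last_step_distinguished:
  assumes n: "n \<ge> 3" and A: "A \<in> D n"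
  shows "last_step C n A \<in> M (n - 1) (face n 0 A) (rotated_face C n A)"
proof -
  let ?U = "inv_rot C n A"
  have U: "?U \<in> D n" using inv_rot_D n A by simp
  have "face_step C n ?U n = last_step C n A"
    unfolding face_step_def last_step_def
    by (rule restr2_cong) (use n in \<open>auto simp: inv_rot_sel skip_def\<close>)
  moreover have "face n n ?U = face n 0 A"
    unfolding face_def by (rule mk_tri_cong) (use n in \<open>auto simp: inv_rot_sel skip_def\<close>)
  moreover have "face n (n - 1) ?U = rotated_face C n A"
    unfolding face_def rotated_face_def[of C n A]
    by (rule mk_tri_cong) (use n in \<open>auto simp: inv_rot_sel skip_def\<close>)
  ultimately show ?thesis using face_step_distinguished[OF n U, of n] n by simp
qed

end

theorem proposition3p8:
  fixes C :: "('o, 'a, 'z) shift_cat_scheme"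
    and D :: "nat \<Rightarrow> ('o, 'a) tri set"
    and M :: "nat \<Rightarrow> ('o, 'a) tri \<Rightarrow> ('o, 'a) tri \<Rightarrow> 'a trimap set"
    and n :: nat and \<delta> :: "('o, 'a) tri"
  assumes "fully_triangulated C D M"
    and "n \<ge> 3"
    and "\<delta> \<in> D n"
  shows "(\<forall>k. 1 \<le> k \<and> k \<le> n \<longrightarrow>
            face_step C n \<delta> k \<in> M (n - 1) (face n k \<delta>) (face n (k - 1) \<delta>)) \<and>
         last_step C n \<delta> \<in> M (n - 1) (face n 0 \<delta>) (rotated_face C n \<delta>)"
  using fully_triangulated.face_step_distinguished[OF assms]
    fully_triangulated.last_step_distinguished[OF assms] by blast

end
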